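(* Let $p\geq 5$ be a prime with $\left(\frac{-10}{p}\right)=-1$. Then for all integers $\alpha\geq 1$, $n\geq 0$ and $i\in\{1,2,\ldots,p-1\}$, \[ \mathfrak{B}_5\!\left(40\cdot p^{2\alpha}n+\frac{5\cdot (24i+7p)p^{2\alpha-1}+1}{3}\right)\equiv 0 \pmod 2 . \]
   Context: For $|q|<1$ write $(a;q)_\infty=\prod_{j=0}^{\infty}(1-aq^j)$. For an integer $k\geq 3$, $\mathfrak{B}_k(n)$ denotes the number of $k$ dots bracelet partitions of $n$; these integers are determined by the generating function \[ \sum_{n=0}^{\infty}\mathfrak{B}_{k}(n)q^n=\frac{(-q;q)_{\infty}}{(q;q)_{\infty}^{k-1}(-q^k;q^k)_{\infty}} . \] Here it is used with $k=5$. The symbol $\left(\frac{a}{p}\right)$ is the Legendre symbol. *)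

theory Defs
  imports
    "HOL-Analysis.Infinite_Products"
    "HOL-Computational_Algebra.Formal_Power_Series"
    "HOL-Number_Theory.Number_Theory"
begin

text \<open>
  The symbol \<open>(a; q)\<^sub>\<infinity>\<close>.  It is polymorphic so that \<open>q\<close> may be a complex number of modulus
  less than 1 or, as below, a formal power series without constant term; in the latter case the
  infinite product is taken in the usual topology of formal power series.
\<close>

definition q_poch_inf :: "'a \<Rightarrow> 'a \<Rightarrow> 'a :: {t2_space, comm_ring_1}" where
  "q_poch_inf a q = (\<Prod>j. 1 - a * q ^ j)"

text \<open>
  The generating function of the \<open>k\<close> dots bracelet partitions, with the indeterminate \<open>fps_X\<close>
  as \<open>q\<close>.  The denominator has constant coefficient 1, so it is invertible over the integers and
  the quotient is formed there; see \<open>bracelet_gf_mult_denom\<close> below.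
\<close>

definition bracelet_gf_denom :: "nat \<Rightarrow> int fps" where
  "bracelet_gf_denom k =
     q_poch_inf fps_X fps_X ^ (k - 1) * q_poch_inf (- (fps_X ^ k)) (fps_X ^ k)"

definition bracelet_gf :: "nat \<Rightarrow> int fps" where
  "bracelet_gf k = q_poch_inf (- fps_X) fps_X * fps_right_inverse (bracelet_gf_denom k) 1"

definition bracelet :: "nat \<Rightarrow> nat \<Rightarrow> int" where
  "bracelet k n = fps_nth (bracelet_gf k) n"

text \<open>The infinite products involved really converge, so that \<open>prodinf\<close> has its intended value.\<close>

lemma fps_has_prod_q_poch_inf:
  fixes a q :: "int fps"
  assumes a: "fps_nth a 0 = 0" and q: "fps_nth q 0 = 0"
  shows "(\<lambda>j. 1 - a * q ^ j) has_prod q_poch_inf a q"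
    and "fps_nth (q_poch_inf a q) 0 = 1"
proof -
  define P where "P n = (\<Prod>j\<le>n. 1 - a * q ^ j)" for n
  define L where "L = Abs_fps (\<lambda>m. fps_nth (P m) m)"
  have low: "fps_nth (a * q ^ j) m = 0" if "m \<le> j" for j m
  proof -
    have qj: "fps_nth (q ^ j) i = 0" if "i < j" for i
      using startsby_zero_power_prefix[OF q, of j] that by simp
    have "fps_nth a i * fps_nth (q ^ j) (m - i) = 0" if "i \<in> {0..m}" for i
      using a qj[of "m - i"] that \<open>m \<le> j\<close> by (cases "i = 0") auto
    then show ?thesis
      unfolding fps_mult_nth by (intro sum.neutral ballI)
  qed
  have step: "fps_nth (P (Suc n)) m = fps_nth (P n) m" if "m \<le> n" for m n
  proof -
    have "P (Suc n) = P n - P n * (a * q ^ Suc n)"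
      by (simp add: P_def algebra_simps)
    moreover have "fps_nth (P n * (a * q ^ Suc n)) m = 0"
    proof -
      have "fps_nth (P n) j * fps_nth (a * q ^ Suc n) (m - j) = 0" for j
        using low[of "m - j" "Suc n"] that by (simp del: power_Suc)
      then show ?thesis
        unfolding fps_mult_nth[of "P n"] by (intro sum.neutral ballI)
    qed
    ultimately show ?thesis by simp
  qed
  have stable: "fps_nth (P n) m = fps_nth L m" if "m \<le> n" for m n
    using that by (induction n rule: dec_induct) (simp_all add: L_def step)
  have "P \<longlonglongrightarrow> L"
    by (rule tendsto_fpsI) (auto simp: eventually_at_top_linorder intro: stable)
  moreover have L0: "fps_nth L 0 = 1"
    using a by (simp add: L_def P_def)
  moreover from L0 have "L \<noteq> 0" by auto
  ultimately have hp: "(\<lambda>j. 1 - a * q ^ j) has_prod L"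
    by (simp add: has_prod_def raw_has_prod_def P_def [abs_def])
  have "q_poch_inf a q = L"
    unfolding q_poch_inf_def using hp by (rule has_prod_unique [symmetric])
  with hp L0 show "(\<lambda>j. 1 - a * q ^ j) has_prod q_poch_inf a q"
    and "fps_nth (q_poch_inf a q) 0 = 1" by simp_all
qed

lemma bracelet_gf_mult_denom:
  assumes "k \<ge> 1"
  shows "bracelet_gf k * (q_poch_inf fps_X fps_X ^ (k - 1) * q_poch_inf (- (fps_X ^ k)) (fps_X ^ k))
           = q_poch_inf (- fps_X) fps_X"
proof -
  have "fps_nth (bracelet_gf_denom k) 0 = 1"
    using assms fps_has_prod_q_poch_inf(2)[of fps_X fps_X]
      fps_has_prod_q_poch_inf(2)[of "- (fps_X ^ k)" "fps_X ^ k"]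
    by (simp add: bracelet_gf_denom_def fps_power_zeroth)
  then have "bracelet_gf_denom k * fps_right_inverse (bracelet_gf_denom k) 1 = 1"
    by (intro fps_right_inverse) simp
  then show ?thesis
    unfolding bracelet_gf_def bracelet_gf_denom_def [symmetric]
    by (metis mult.assoc mult.commute mult_1_right)
qed

text \<open>The fraction in the argument of the congruence is an integer.\<close>

lemma three_dvd_bracelet_index:
  fixes p \<alpha> i :: nat
  assumes "prime p" "p \<ge> 5" "\<alpha> \<ge> 1"
  shows "3 dvd 5 * (24 * i + 7 * p) * p ^ (2 * \<alpha> - 1) + 1"
proof -
  have "\<not> 3 dvd p"
    using assms primes_dvd_imp_eq[of 3 p] by auto
  then have "p mod 3 = 1 \<or> p mod 3 = 2" by presburger
  moreover have "p ^ 2 mod 3 = (p mod 3) ^ 2 mod 3"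
    by (simp add: power_mod)
  ultimately have "p ^ 2 mod 3 = 1"
    by auto
  then have p1: "p ^ (2 * \<alpha>) mod 3 = 1"
    using power_mod[of "p ^ 2" 3 \<alpha>] by (simp add: power_mult)
  have "p * p ^ (2 * \<alpha> - 1) = p ^ (2 * \<alpha>)"
    using assms(3) by (simp flip: power_Suc)
  then have "5 * (24 * i + 7 * p) * p ^ (2 * \<alpha> - 1) + 1
               = 3 * (40 * i * p ^ (2 * \<alpha> - 1)) + 35 * p ^ (2 * \<alpha>) + 1"
    by (simp add: algebra_simps)
  with p1 show ?thesis by presburger
qed

end

theory Submission
  imports Defs "HOL-Library.Z2" "HOL-Computational_Algebra.Formal_Laurent_Series"
begin

text \<open>
  Modulo 2 the substitution \<open>q \<mapsto> q\<^sup>2\<close> is squaring, and the signs disappear. Write \<open>a\<close> for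
  \<open>(q; q)\<^sub>\<infinity>\<close> and \<open>b\<close> for \<open>(q\<^sup>5; q\<^sup>5)\<^sub>\<infinity>\<close>, both with coefficients in the field of two elements. The
  generating function for \<open>k = 5\<close> becomes \<open>1 / (a\<^sup>3 b)\<close>, and everything rests on the single relation
  \<open>a b = a\<^sup>6 + q b\<^sup>6\<close> (lemma \<open>phi_mult_phi5\<close>, where \<open>a\<close> and \<open>b\<close> are called \<open>phi\<close> and \<open>phi5\<close>).
  Since \<open>a\<^sup>6\<close> and \<open>b\<^sup>6\<close> are squares, that is, series in \<open>q\<^sup>2\<close>, multiplying a quotient by
  \<open>a b\<close> splits it into its even and odd parts. Three such splittings and one extraction of
  the exponents congruent to 1 modulo 5 give
  \<open>1 / (a\<^sup>3 b) \<rightarrow> a / b \<rightarrow> b / a \<rightarrow> b\<^sup>3 / a \<rightarrow> a\<^sup>2 b\<close>,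
  so that the coefficient at \<open>40 m + 12\<close> of the generating function is the coefficient
  at \<open>m\<close> of \<open>a\<^sup>2 b\<close> (lemma \<open>bracelet_5_section\<close>).

  By the pentagonal number theorem \<open>a\<close> is supported on those \<open>n\<close> for which \<open>24 n + 1\<close> is a square.
  Hence a nonzero coefficient of \<open>a\<^sup>2 b\<close> at \<open>m\<close> forces \<open>24 m + 7 = 2 x\<^sup>2 + 5 y\<^sup>2\<close>. If -10 is not a square
  modulo \<open>p\<close>, then \<open>p\<close> divides such a value only if it divides both \<open>x\<close> and \<open>y\<close>, and by descent it
  divides it to an even power. The indices of the theorem are those with \<open>24 m + 7\<close> equal to
  \<open>p\<^bsup>2\<alpha>-1\<^esup>\<close> times a number congruent to \<open>24 i\<close>, hence not to 0, modulo \<open>p\<close>; there \<open>p\<close> occurs to an odd power.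

  The relation between \<open>a\<close> and \<open>b\<close> is a reduction of Ramanujan's identity
  \<open>\<psi>(q)\<^sup>2 - q \<psi>(q\<^sup>5)\<^sup>2 = f(q, q\<^sup>4) f(q\<^sup>2, q\<^sup>3)\<close>. By the Jacobi triple product, \<open>a b\<close> is the theta product on the
  right and \<open>a\<^sup>3\<close> is \<open>\<psi>(q)\<close>. The theta product counts certain pairs of odd numbers with
  \<open>x\<^sup>2 + y\<^sup>2 = 5 (8 n + 2)\<close>; division by the Gaussian integer \<open>1 + 2 i\<close> relates them to pairs with sum of
  squares \<open>8 n + 2\<close>, whose number modulo 2 is found by exchanging the two coordinates.
\<close>

section \<open>Infinite q-Pochhammer symbols of formal power series\<close>

text \<open>
  Agreement of two series up to the coefficient of \<open>q\<^sup>m\<close> is a congruence for sums and products. It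
  replaces limits below: two series are equal as soon as each is approximated by the
  same finite products to every order.
\<close>

definition fps_agree :: "nat \<Rightarrow> 'a::zero fps \<Rightarrow> 'a fps \<Rightarrow> bool" where
  "fps_agree m f g \<longleftrightarrow> (\<forall>i\<le>m. fps_nth f i = fps_nth g i)"

lemma fps_agree_refl [simp]: "fps_agree m f f"
  by (simp add: fps_agree_def)

lemma fps_agree_sym: "fps_agree m f g \<Longrightarrow> fps_agree m g f"
  by (simp add: fps_agree_def)

lemma fps_agree_trans: "fps_agree m f g \<Longrightarrow> fps_agree m g h \<Longrightarrow> fps_agree m f h"
  by (simp add: fps_agree_def)

lemma fps_agree_mult:
  "fps_agree m f f' \<Longrightarrow> fps_agree m g g' \<Longrightarrow> fps_agree m (f * g) (f' * g')"
  for f g :: "'a::semiring_0 fps"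
  by (auto simp: fps_agree_def fps_mult_nth intro!: sum.cong)

lemma fps_agree_sum:
  "(\<And>k. k \<in> A \<Longrightarrow> fps_agree m (f k) (g k)) \<Longrightarrow> fps_agree m (sum f A) (sum g A)"
  for f g :: "'b \<Rightarrow> 'a::comm_monoid_add fps"
  by (auto simp: fps_agree_def fps_sum_nth intro!: sum.cong)

lemma fps_agree_prod:
  "(\<And>k. k \<in> A \<Longrightarrow> fps_agree m (f k) (g k)) \<Longrightarrow> fps_agree m (prod f A) (prod g A)"
  for f g :: "'b \<Rightarrow> 'a::comm_semiring_1 fps"
  by (induction A rule: infinite_finite_induct) (auto intro: fps_agree_mult)

lemma fps_eqI_agree: "(\<And>m. \<exists>h. fps_agree m f h \<and> fps_agree m g h) \<Longrightarrow> f = g"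
  by (metis fps_agree_def fps_ext order_refl)

definition q_poch :: "'a \<Rightarrow> 'a \<Rightarrow> nat \<Rightarrow> 'a::comm_ring_1" where
  "q_poch a q n = (\<Prod>j<n. 1 - a * q ^ j)"

lemma fps_nth_mult_power_eq_0:
  fixes a q :: "'a::comm_ring_1 fps"
  assumes "fps_nth a 0 = 0" "fps_nth q 0 = 0" "m \<le> j"
  shows "fps_nth (a * q ^ j) m = 0"
proof -
  have qj: "fps_nth (q ^ j) i = 0" if "i < j" for i
    using startsby_zero_power_prefix[OF assms(2), of j] that by simp
  have "fps_nth a i * fps_nth (q ^ j) (m - i) = 0" if "i \<le> m" for i
    using assms(1,3) qj[of "m - i"] that by (cases "i = 0") auto
  then show ?thesis
    by (simp add: fps_mult_nth)
qed

lemma q_poch_agree: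
  fixes a q :: "'a::comm_ring_1 fps"
  assumes "fps_nth a 0 = 0" "fps_nth q 0 = 0" "m < n" "n \<le> n'"
  shows "fps_agree m (q_poch a q n') (q_poch a q n)"
  using assms(4)
proof (induction n' rule: dec_induct)
  case (step k)
  have "fps_agree m (1 - a * q ^ k) 1"
    using assms step(1) fps_nth_mult_power_eq_0[of a q _ k] by (auto simp: fps_agree_def)
  from fps_agree_mult[OF step.IH this] show ?case
    by (simp add: q_poch_def)
qed simp

lemma q_poch_inf_agree:
  fixes a q :: "'a::idom fps"
  assumes "fps_nth a 0 = 0" "fps_nth q 0 = 0" "m < n"
  shows "fps_agree m (q_poch_inf a q) (q_poch a q n)"
proof -
  define L where "L = Abs_fps (\<lambda>m. fps_nth (q_poch a q (Suc m)) m)"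
  have L: "fps_agree m L (q_poch a q n)" if "m < n" for m n
    unfolding fps_agree_def
  proof (intro allI impI)
    fix i assume "i \<le> m"
    then show "fps_nth L i = fps_nth (q_poch a q n) i"
      using q_poch_agree[OF assms(1,2), of i "Suc i" n] that by (simp add: fps_agree_def L_def)
  qed
  have "(\<lambda>n. q_poch a q (Suc n)) \<longlonglongrightarrow> L"
  proof (rule tendsto_fpsI)
    fix m
    show "\<forall>\<^sub>F n in sequentially. fps_nth (q_poch a q (Suc n)) m = fps_nth L m"
    proof (rule eventually_mono[OF eventually_ge_at_top[of m]])
      fix n assume "m \<le> n"
      then show "fps_nth (q_poch a q (Suc n)) m = fps_nth L m"
        using L[of m "Suc n"] by (simp add: fps_agree_def)
    qed
  qed
  moreover have "L \<noteq> 0"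
  proof -
    have "fps_nth L 0 = 1"
      using assms(1) by (simp add: L_def q_poch_def)
    then show ?thesis by auto
  qed
  ultimately have "(\<lambda>j. 1 - a * q ^ j) has_prod L"
    by (simp add: has_prod_def raw_has_prod_def q_poch_def lessThan_Suc_atMost)
  then have "q_poch_inf a q = L"
    unfolding q_poch_inf_def by (rule has_prod_unique [symmetric])
  with L assms(3) show ?thesis by simp
qed

lemma fps_nth_0_q_poch_inf:
  fixes a q :: "'a::idom fps"
  assumes "fps_nth a 0 = 0" "fps_nth q 0 = 0"
  shows "fps_nth (q_poch_inf a q) 0 = 1"
  using q_poch_inf_agree[OF assms, of 0 1] assms(1) by (simp add: fps_agree_def q_poch_def)

text \<open>
  Every \<open>j\<close> is uniquely \<open>i + k d\<close> with \<open>i < d\<close>, so the factors can be sorted by their index modulo \<open>d\<close>.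
  This rewrites the products in the triple product identity as Euler products.
\<close>

lemma q_poch_inf_section:
  fixes a q :: "'a::idom fps"
  assumes "fps_nth a 0 = 0" "fps_nth q 0 = 0" "d > 0"
  shows "q_poch_inf a q = (\<Prod>i<d. q_poch_inf (a * q ^ i) (q ^ d))"
proof (rule fps_eqI_agree)
  fix m
  have eq: "q_poch a q (Suc m * d) = (\<Prod>i<d. q_poch (a * q ^ i) (q ^ d) (Suc m))"
  proof -
    have "q_poch a q (Suc m * d) = (\<Prod>k<Suc m. \<Prod>i\<in>{k * d..<k * d + d}. 1 - a * q ^ i)"
      unfolding q_poch_def by (rule prod.nat_group [symmetric])
    also have "\<dots> = (\<Prod>k<Suc m. \<Prod>i<d. 1 - a * q ^ (i + k * d))"
      using prod.shift_bounds_nat_ivl[of "\<lambda>i. 1 - a * q ^ i" 0 "_ * d" d]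
      by (simp add: lessThan_atLeast0 add.commute)
    also have "\<dots> = (\<Prod>k<Suc m. \<Prod>i<d. 1 - (a * q ^ i) * (q ^ d) ^ k)"
      by (simp add: power_add power_mult [symmetric] mult_ac)
    also have "\<dots> = (\<Prod>i<d. \<Prod>k<Suc m. 1 - (a * q ^ i) * (q ^ d) ^ k)"
      by (rule prod.swap)
    finally show ?thesis by (simp add: q_poch_def)
  qed
  have "m < Suc m * d"
    using assms(3) mult_le_mono2[of 1 d "Suc m"] by simp
  then have "fps_agree m (q_poch_inf a q) (q_poch a q (Suc m * d))"
    using assms by (intro q_poch_inf_agree) auto
  moreover have "fps_agree m (\<Prod>i<d. q_poch_inf (a * q ^ i) (q ^ d)) (q_poch a q (Suc m * d))"
    unfolding eq using assms by (intro fps_agree_prod q_poch_inf_agree) (auto simp: fps_power_zeroth)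
  ultimately show "\<exists>h. fps_agree m (q_poch_inf a q) h \<and>
      fps_agree m (\<Prod>i<d. q_poch_inf (a * q ^ i) (q ^ d)) h" by blast
qed

section \<open>The Jacobi triple product\<close>

text \<open>
  The Gaussian binomial coefficients, defined by a Pascal rule so that they make sense in every
  commutative ring; \<open>q_binom_mult_q_poch\<close> recovers the usual quotient without dividing.
\<close>

fun q_binom :: "'a::comm_ring_1 \<Rightarrow> nat \<Rightarrow> nat \<Rightarrow> 'a" where
  "q_binom q n 0 = 1"
| "q_binom q 0 (Suc k) = 0"
| "q_binom q (Suc n) (Suc k) = q_binom q n k + q ^ Suc k * q_binom q n (Suc k)"

lemma q_binom_eq_0: "n < k \<Longrightarrow> q_binom q n k = 0"
  by (induction q n k rule: q_binom.induct) auto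

lemma q_poch_0: "q_poch a q 0 = 1"
  by (simp add: q_poch_def)

lemma q_poch_Suc: "q_poch q q (Suc n) = q_poch q q n * (1 - q ^ Suc n)"
  by (simp add: q_poch_def)

lemma q_binom_mult_q_poch:
  "q_binom q (k + l) k * q_poch q q k * q_poch q q l = q_poch q q (k + l)"
proof (induction "k + l" arbitrary: k l)
  case 0
  then show ?case by (simp add: q_poch_def)
next
  case (Suc n)
  show ?case
  proof (cases k)
    case 0
    then show ?thesis by (simp add: q_poch_def)
  next
    case (Suc k')
    show ?thesis
    proof (cases l)
      case 0
      have 1: "q_binom q k' k' * q_poch q q k' = q_poch q q k'"
        using Suc.hyps(1)[of k' 0] Suc.hyps(2) Suc 0 by (simp add: q_poch_def)
      then show ?thesis
        using 0 \<open>k = Suc k'\<close> q_binom_eq_0[of k' "Suc k'" q]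
        by (simp add: q_poch_Suc q_poch_0 mult.assoc [symmetric] del: power_Suc)
    next
      case (Suc l')
      have n: "k' + l = n" "k + l' = n" "k + l = Suc n"
        using Suc.hyps(2) \<open>k = Suc k'\<close> Suc by auto
      have 1: "q_binom q n k' * q_poch q q k' * q_poch q q l = q_poch q q n"
        using Suc.hyps(1)[of k' l] n by simp
      have 2: "q_binom q n k * q_poch q q k * q_poch q q l' = q_poch q q n"
        using Suc.hyps(1)[of k l'] n by simp
      have binom: "q_binom q (k + l) k = q_binom q n k' + q ^ k * q_binom q n k"
        by (subst n(3)) (simp only: \<open>k = Suc k'\<close> q_binom.simps)
      have poch: "q_poch q q k = q_poch q q k' * (1 - q ^ k)"
          "q_poch q q l = q_poch q q l' * (1 - q ^ l)"
        by (simp_all only: \<open>k = Suc k'\<close> Suc q_poch_Suc)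
      have "q_binom q (k + l) k * q_poch q q k * q_poch q q l
          = (q_binom q n k' * q_poch q q k' * q_poch q q l) * (1 - q ^ k)
            + q ^ k * (q_binom q n k * q_poch q q k * q_poch q q l') * (1 - q ^ l)"
        unfolding binom poch by (simp add: algebra_simps)
      also have "\<dots> = q_poch q q n * (1 - q ^ k * q ^ l)"
        unfolding 1 2 by (simp add: algebra_simps)
      also have "\<dots> = q_poch q q (k + l)"
        unfolding n(3) q_poch_Suc using n(3) by (simp add: power_add [symmetric])
      finally show ?thesis .
    qed
  qed
qed

text \<open>
  The homogeneous form, with \<open>w\<close> in place of 1, is what makes the shift \<open>z \<mapsto> z q\<^sup>-\<^sup>n\<close> in the proof of the
  triple product possible without negative powers.
\<close>

lemma q_binomial_theorem:
  fixes q w z :: "'a::comm_ring_1"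
  shows "(\<Prod>i<n. w + z * q ^ i)
       = (\<Sum>k\<le>n. q ^ (k choose 2) * q_binom q n k * z ^ k * w ^ (n - k))"
proof (induction n arbitrary: z)
  case 0
  then show ?case by (simp add: numeral_2_eq_2)
next
  case (Suc n)
  define t where "t k = q ^ (k choose 2) * q_binom q n k * (z * q) ^ k * w ^ (n - k)" for k
  have w: "w * t k = q ^ (k choose 2) * (q ^ k * q_binom q n k) * z ^ k * w ^ (Suc n - k)"
    if "k \<le> n" for k
    using that by (simp add: t_def Suc_diff_le power_mult_distrib mult_ac)
  have z: "z * t k = q ^ (Suc k choose 2) * q_binom q n k * z ^ Suc k * w ^ (n - k)" for k
    by (simp add: t_def numeral_2_eq_2 power_add power_mult_distrib mult_ac)
  have "(\<Prod>i<Suc n. w + z * q ^ i) = (w + z) * (\<Prod>i<n. w + (z * q) * q ^ i)"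
    by (subst prod.lessThan_Suc_shift) (simp add: mult_ac)
  also have "\<dots> = (w + z) * (\<Sum>k\<le>n. t k)"
    by (simp add: Suc.IH t_def)
  also have "\<dots> = (\<Sum>k\<le>n. w * t k) + (\<Sum>k\<le>n. z * t k)"
    unfolding distrib_right by (simp only: sum_distrib_left)
  also have "(\<Sum>k\<le>n. w * t k)
      = (\<Sum>k\<le>Suc n. q ^ (k choose 2) * (q ^ k * q_binom q n k) * z ^ k * w ^ (Suc n - k))"
    by (simp add: w q_binom_eq_0)
  also have "\<dots> = w ^ Suc n + (\<Sum>k\<le>n. q ^ (Suc k choose 2) * (q ^ Suc k * q_binom q n (Suc k))
                    * z ^ Suc k * w ^ (n - k))"
    by (subst sum.atMost_Suc_shift) (simp add: numeral_2_eq_2)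
  also have "\<dots> + (\<Sum>k\<le>n. z * t k)
      = w ^ Suc n + (\<Sum>k\<le>n. q ^ (Suc k choose 2) * q_binom q (Suc n) (Suc k)
                    * z ^ Suc k * w ^ (n - k))"
    by (simp only: z add.assoc sum.distrib [symmetric] q_binom.simps)
       (simp only: algebra_simps)
  also have "\<dots> = (\<Sum>k\<le>Suc n. q ^ (k choose 2) * q_binom q (Suc n) k * z ^ k * w ^ (Suc n - k))"
    by (subst sum.atMost_Suc_shift) (simp add: numeral_2_eq_2)
  finally show ?case .
qed

text \<open>
  The exponent of \<open>q\<close> in the \<open>k\<close>-th term \<open>x\<^bsup>k(k+1)/2\<^esup> y\<^bsup>k(k-1)/2\<^esup>\<close> of Ramanujan's theta function \<open>f(x, y)\<close> at
  \<open>x = q\<^sup>r\<close> and \<open>y = q\<^sup>s\<close>.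
\<close>

definition theta_exp :: "nat \<Rightarrow> nat \<Rightarrow> int \<Rightarrow> nat" where
  "theta_exp r s k = nat ((int r * (k * (k + 1)) + int s * (k * (k - 1))) div 2)"

lemma two_times_theta_exp:
  "2 * int (theta_exp r s k) = int r * (k * (k + 1)) + int s * (k * (k - 1))"
proof -
  have nonneg: "0 \<le> k * (k + 1)" "0 \<le> k * (k - 1)"
    by (cases "k \<ge> 0"; cases "k \<ge> 1"; auto simp: zero_le_mult_iff)+
  define e where "e = int r * (k * (k + 1)) + int s * (k * (k - 1))"
  have "even e" by (simp add: e_def)
  moreover have "e \<ge> 0"
    using nonneg by (simp add: e_def)
  ultimately show ?thesis
    unfolding theta_exp_def e_def [symmetric] by simp
qed

lemma theta_exp_ge_square:
  assumes "r > 0" "s > 0"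
  shows "k ^ 2 \<le> int (theta_exp r s k)"
proof -
  have nonneg: "0 \<le> k * (k + 1)" "0 \<le> k * (k - 1)"
    by (cases "k \<ge> 0"; cases "k \<ge> 1"; auto simp: zero_le_mult_iff)+
  have "1 * (k * (k + 1)) + 1 * (k * (k - 1)) \<le> 2 * int (theta_exp r s k)"
    unfolding two_times_theta_exp using nonneg assms
    by (intro add_mono mult_right_mono) auto
  then show ?thesis by (simp add: power2_eq_square algebra_simps)
qed

lemma abs_le_theta_exp:
  assumes "r > 0" "s > 0"
  shows "\<bar>k\<bar> \<le> int (theta_exp r s k)"
proof -
  have "\<bar>k\<bar> \<le> k ^ 2"
    using self_le_power[of "\<bar>k\<bar>" 2] by (cases "k = 0") simp_all
  also have "\<dots> \<le> int (theta_exp r s k)"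
    using assms by (rule theta_exp_ge_square)
  finally show ?thesis .
qed

text \<open>
  This is the \<open>q\<close>-binomial theorem for \<open>2 n\<close> factors with \<open>w = q\<^sup>n\<close> and \<open>z = x\<close>. As \<open>x y = q\<close>, the lower half
  of the factors equals \<open>x q\<^sup>i (1 + y q\<^bsup>n-1-i\<^esup>)\<close> and the upper half \<open>q\<^sup>n (1 + x q\<^sup>i)\<close>. The monomials
  taken out are the same power of the indeterminate as the one common to all terms of
  the sum, and cancelling it leaves the theta exponents.
\<close>

lemma finite_triple_product:
  fixes x y q :: "'a::idom fps"
  assumes "x = fps_X ^ r" "y = fps_X ^ s" "q = fps_X ^ (r + s)"
  shows "q_poch (- x) q n * q_poch (- y) q n
       = (\<Sum>k\<le>2 * n. q_binom q (2 * n) k * fps_X ^ theta_exp r s (int k - int n))"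
proof -
  define c where "c = (r + s) * (n * n) + r * n + (r + s) * (n choose 2)"
  have xy: "x * y = q"
    using assms by (simp add: power_add)
  have low: "(\<Prod>i<n. q ^ n + x * q ^ i) = x ^ n * q ^ (n choose 2) * q_poch (- y) q n"
  proof -
    have "(\<Prod>i<n. q ^ n + x * q ^ i) = (\<Prod>i<n. (x * q ^ i) * (1 + y * q ^ (n - Suc i)))"
    proof (intro prod.cong refl)
      fix i assume "i \<in> {..<n}"
      then have "q ^ n = q * q ^ i * q ^ (n - Suc i)"
        by (simp flip: power_add power_Suc)
      then show "q ^ n + x * q ^ i = (x * q ^ i) * (1 + y * q ^ (n - Suc i))"
        unfolding xy [symmetric] by (simp add: algebra_simps)
    qed
    also have "\<dots> = x ^ n * q ^ (\<Sum>i<n. i) * (\<Prod>i<n. 1 + y * q ^ (n - Suc i))"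
      by (simp add: prod.distrib power_sum)
    also have "(\<Prod>i<n. 1 + y * q ^ (n - Suc i)) = (\<Prod>i<n. 1 + y * q ^ i)"
      by (rule prod.nat_diff_reindex)
    also have "(\<Sum>i<n. i) = n choose 2"
      by (induction n) (simp_all add: numeral_2_eq_2)
    finally show ?thesis by (simp add: q_poch_def)
  qed
  have high: "(\<Prod>i\<in>{n..<2 * n}. q ^ n + x * q ^ i) = q ^ (n * n) * q_poch (- x) q n"
  proof -
    have "(\<Prod>i\<in>{n..<2 * n}. q ^ n + x * q ^ i) = (\<Prod>i<n. q ^ n + x * q ^ (i + n))"
      using prod.shift_bounds_nat_ivl[of "\<lambda>i. q ^ n + x * q ^ i" 0 n n]
      by (simp add: lessThan_atLeast0 mult_2)
    also have "\<dots> = (\<Prod>i<n. q ^ n * (1 + x * q ^ i))"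
      by (simp add: power_add algebra_simps)
    finally show ?thesis by (simp add: prod.distrib q_poch_def power_mult)
  qed
  have X_c: "fps_X ^ c = q ^ (n * n) * x ^ n * q ^ (n choose 2)"
    by (simp only: c_def assms power_mult [symmetric] power_add [symmetric])
  have "(\<Prod>i<2 * n. q ^ n + x * q ^ i)
      = (\<Prod>i<n. q ^ n + x * q ^ i) * (\<Prod>i\<in>{n..<2 * n}. q ^ n + x * q ^ i)"
    using prod.atLeastLessThan_concat[of 0 n "2 * n" "\<lambda>i. q ^ n + x * q ^ i"]
    by (simp add: lessThan_atLeast0)
  also have "\<dots> = fps_X ^ c * (q_poch (- x) q n * q_poch (- y) q n)"
    unfolding low high X_c by (simp only: mult_ac)
  finally have "fps_X ^ c * (q_poch (- x) q n * q_poch (- y) q n)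
      = (\<Sum>k\<le>2 * n. q ^ (k choose 2) * q_binom q (2 * n) k * x ^ k * (q ^ n) ^ (2 * n - k))"
    by (simp add: q_binomial_theorem)
  also have "\<dots> = (\<Sum>k\<le>2 * n. fps_X ^ c *
                    (q_binom q (2 * n) k * fps_X ^ theta_exp r s (int k - int n)))"
  proof (intro sum.cong refl)
    fix k assume "k \<in> {..2 * n}"
    then have k: "k \<le> 2 * n" by simp
    have choose: "2 * int (m choose 2) = int m * (int m - 1)" for m
      by (induction m) (simp_all add: numeral_2_eq_2 algebra_simps)
    have "2 * int ((r + s) * (k choose 2) + r * k + (r + s) * n * (2 * n - k))
        = 2 * int (c + theta_exp r s (int k - int n))"
    proof -
      have d: "int (2 * n - k) = 2 * int n - int k" using k by simp
      have "2 * int ((r + s) * (k choose 2) + r * k + (r + s) * n * (2 * n - k))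
          = (int r + int s) * (2 * int (k choose 2)) + 2 * int r * int k
            + 2 * (int r + int s) * int n * (2 * int n - int k)"
        by (simp only: of_nat_add of_nat_mult d) (simp only: algebra_simps)
      also have "\<dots> = 2 * ((int r + int s) * (int n * int n)) + 2 * int r * int n
            + (int r + int s) * (2 * int (n choose 2)) + 2 * int (theta_exp r s (int k - int n))"
        unfolding choose two_times_theta_exp by (simp add: algebra_simps)
      also have "\<dots> = 2 * int (c + theta_exp r s (int k - int n))"
        by (simp only: c_def of_nat_add of_nat_mult) (simp only: algebra_simps)
      finally show ?thesis .
    qed
    then have "(r + s) * (k choose 2) + r * k + (r + s) * n * (2 * n - k)
        = c + theta_exp r s (int k - int n)"
      by (simp only: mult_cancel_left of_nat_eq_iff numeral_neq_zero simp_thms)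
    then have "fps_X ^ ((r + s) * (k choose 2)) * fps_X ^ (r * k)
          * fps_X ^ ((r + s) * n * (2 * n - k))
        = fps_X ^ c * (fps_X ^ theta_exp r s (int k - int n) :: 'a fps)"
      by (simp only: power_add [symmetric])
    then show "q ^ (k choose 2) * q_binom q (2 * n) k * x ^ k * (q ^ n) ^ (2 * n - k)
        = fps_X ^ c * (q_binom q (2 * n) k * fps_X ^ theta_exp r s (int k - int n))"
      unfolding assms power_mult [symmetric] by (simp add: mult_ac)
  qed
  finally show ?thesis
    by (simp add: sum_distrib_left [symmetric])
qed

text \<open>
  In the finite identity each Gaussian binomial coefficient tends to \<open>1 / (q; q)\<^sub>\<infinity>\<close>. To a
  fixed order \<open>m\<close> only the terms with both \<open>k\<close> and \<open>2 n - k\<close> larger than \<open>m\<close> matter, because the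
  theta exponent at \<open>k - n\<close> is at least \<open>(k - n)\<^sup>2\<close>.
\<close>

theorem jacobi_triple_product:
  fixes x y q :: "'a::idom fps"
  assumes "r > 0" "s > 0"
    and xyq: "x = fps_X ^ r" "y = fps_X ^ s" "q = fps_X ^ (r + s)"
  shows "q_poch_inf (- x) q * q_poch_inf (- y) q * q_poch_inf q q
       = Abs_fps (\<lambda>m. of_nat (card {k. theta_exp r s k = m}))"
proof (rule fps_ext)
  fix m
  \<comment> \<open>With this \<open>n\<close>, at each \<open>k \<le> 2 n\<close> either both \<open>k\<close> and \<open>2 n - k\<close> exceed \<open>m\<close>, or \<open>k\<close> is at distance
    more than \<open>m\<close> from \<open>n\<close>.\<close>
  define n where "n = Suc (2 * m)"
  have x0: "fps_nth (- x) 0 = 0" "fps_nth (- y) 0 = 0" "fps_nth q 0 = 0"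
    using assms by (auto simp: fps_X_power_nth)
  define Q where "Q = q_poch_inf q q"
  have Q: "fps_agree m Q (q_poch q q l)" if "m < l" for l
    unfolding Q_def using q_poch_inf_agree x0 that by blast
  \<comment> \<open>\<open>Q\<close> is invertible, so it may be cancelled from agreements.\<close>
  have Q_unit: "fps_agree m f g" if "fps_agree m (f * Q) (g * Q)" for f g :: "'a fps"
  proof -
    have "Q * fps_right_inverse Q 1 = 1"
      using fps_nth_0_q_poch_inf x0 by (intro fps_right_inverse) (simp add: Q_def)
    then show ?thesis
      using fps_agree_mult[OF that fps_agree_refl[of m "fps_right_inverse Q 1"]]
      by (simp add: mult.assoc)
  qed
  have "fps_agree m (q_poch_inf (- x) q * q_poch_inf (- y) q * Q)
          (q_poch (- x) q n * q_poch (- y) q n * Q)"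
    using x0 by (intro fps_agree_mult q_poch_inf_agree fps_agree_refl) (auto simp: n_def)
  also have "q_poch (- x) q n * q_poch (- y) q n * Q
      = (\<Sum>k\<le>2 * n. q_binom q (2 * n) k * Q * fps_X ^ theta_exp r s (int k - int n))"
    unfolding finite_triple_product[OF xyq] sum_distrib_right
    by (intro sum.cong refl) (simp only: mult_ac)
  finally have 1: "fps_agree m (q_poch_inf (- x) q * q_poch_inf (- y) q * Q)
      (\<Sum>k\<le>2 * n. q_binom q (2 * n) k * Q * fps_X ^ theta_exp r s (int k - int n))" .
  have 2: "fps_agree m
      (\<Sum>k\<le>2 * n. q_binom q (2 * n) k * Q * fps_X ^ theta_exp r s (int k - int n))
      (\<Sum>k\<le>2 * n. fps_X ^ theta_exp r s (int k - int n))"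
  proof (rule fps_agree_sum)
    fix k assume k: "k \<in> {..2 * n}"
    define e where "e = theta_exp r s (int k - int n)"
    show "fps_agree m (q_binom q (2 * n) k * Q * fps_X ^ e) (fps_X ^ e)"
    proof (cases "m < k \<and> m < 2 * n - k")
      case True
      have "fps_agree m (q_binom q (2 * n) k * Q * Q)
              (q_binom q (2 * n) k * q_poch q q k * q_poch q q (2 * n - k))"
        using True by (intro fps_agree_mult Q fps_agree_refl) auto
      also have "q_binom q (2 * n) k * q_poch q q k * q_poch q q (2 * n - k) = q_poch q q (2 * n)"
        using q_binom_mult_q_poch[of q k "2 * n - k"] k by simp
      finally have "fps_agree m (q_binom q (2 * n) k * Q * Q) (1 * Q)"
        using Q[of "2 * n"] by (auto simp: n_def intro: fps_agree_trans fps_agree_sym)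
      then have "fps_agree m (q_binom q (2 * n) k * Q) 1" by (rule Q_unit)
      then show ?thesis
        using fps_agree_mult[OF _ fps_agree_refl] by (metis mult_1)
    next
      case False
      then have "\<bar>int k - int n\<bar> \<ge> int m + 1"
        using k by (auto simp: n_def)
      then have "(int m + 1) ^ 2 \<le> (int k - int n) ^ 2"
        using power_mono[of "int m + 1" "\<bar>int k - int n\<bar>" 2] by simp
      also have "\<dots> \<le> int e"
        unfolding e_def using assms by (intro theta_exp_ge_square)
      finally have "m < e"
        using self_le_power[of "int m + 1" 2] by simp
      then show ?thesis
        by (auto simp: fps_agree_def fps_X_power_mult_right_nth fps_X_power_nth)
    qed
  qed
  have "fps_nth (q_poch_inf (- x) q * q_poch_inf (- y) q * Q) m
      = (\<Sum>k\<le>2 * n. if theta_exp r s (int k - int n) = m then 1 else 0)"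
    using fps_agree_trans[OF 1 2]
    by (simp add: fps_agree_def fps_sum_nth fps_X_power_nth eq_commute[of m]
        del: sum.delta sum.delta' sum.If_cases)
  also have "\<dots> = of_nat (card {k \<in> {..2 * n}. theta_exp r s (int k - int n) = m})"
    by (subst sum.inter_filter [symmetric]) simp_all
  also have "card {k \<in> {..2 * n}. theta_exp r s (int k - int n) = m}
      = card {k. theta_exp r s k = m}"
  proof (rule bij_betw_same_card[of "\<lambda>k. int k - int n"], rule bij_betwI[of _ _ _ "\<lambda>k. nat (k + int n)"])
    have "\<bar>k\<bar> \<le> int m" if "theta_exp r s k = m" for k
      using abs_le_theta_exp[OF assms(1,2), of k] that by simp
    then have bound: "- int n \<le> k \<and> k \<le> int n" if "theta_exp r s k = m" for k
      using that by (fastforce simp: n_def)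
    show "(\<lambda>k. nat (k + int n)) \<in> {k. theta_exp r s k = m}
        \<rightarrow> {k \<in> {..2 * n}. theta_exp r s (int k - int n) = m}"
      using bound by force
    show "int (nat (k + int n)) - int n = k" if "k \<in> {k. theta_exp r s k = m}" for k
      using bound that by force
  qed auto
  finally show "fps_nth (q_poch_inf (- x) q * q_poch_inf (- y) q * q_poch_inf q q) m
      = fps_nth (Abs_fps (\<lambda>m. of_nat (card {k. theta_exp r s k = m}))) m"
    by (simp add: Q_def)
qed

section \<open>Power series over the field of two elements\<close>

lemma uminus_bit_fps [simp]: "- f = (f :: bit fps)"
  by (rule fps_ext) simp

text \<open>
  The points that are moved come in pairs with equal values, which cancel modulo 2.
\<close>

lemma sum_bit_involution:
  fixes f :: "'b \<Rightarrow> bit"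
  assumes "finite A" "\<And>x. x \<in> A \<Longrightarrow> h x \<in> A \<and> h (h x) = x \<and> f (h x) = f x"
  shows "sum f A = sum f {x \<in> A. h x = x}"
  using assms
proof (induction A rule: finite_psubset_induct)
  case (psubset A)
  show ?case
  proof (cases "\<exists>x\<in>A. h x \<noteq> x")
    case False
    then have "{x \<in> A. h x = x} = A" by auto
    then show ?thesis by simp
  next
    case True
    then obtain x where x: "x \<in> A" "h x \<noteq> x" by blast
    define B where "B = A - {x, h x}"
    have hx: "h x \<in> A" "h (h x) = x" "f (h x) = f x" using psubset.prems x by auto
    have "sum f A = sum f {x, h x} + sum f B"
      using sum.subset_diff[of "{x, h x}" A f] psubset.hyps hx x by (simp add: B_def add.commute)
    also have "sum f {x, h x} = 0"
      using x hx by simp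
    also have "sum f B = sum f {y \<in> B. h y = y}"
    proof (rule psubset.IH)
      show "B \<subset> A" using x by (auto simp: B_def)
      show "h y \<in> B \<and> h (h y) = y \<and> f (h y) = f y" if "y \<in> B" for y
        using psubset.prems[of y] hx that by (auto simp: B_def)
    qed
    also have "{y \<in> B. h y = y} = {y \<in> A. h y = y}"
      using x hx by (auto simp: B_def)
    finally show ?thesis by simp
  qed
qed

text \<open>
  The Frobenius map: the convolution defining the coefficient is symmetric under \<open>i \<mapsto> n - i\<close>, so
  only the middle term survives.
\<close>

lemma bit_fps_square_nth:
  fixes f :: "bit fps"
  shows "fps_nth (f ^ 2) n = (if even n then fps_nth f (n div 2) else 0)"
proof -
  have "fps_nth (f ^ 2) n = (\<Sum>i = 0..n. fps_nth f i * fps_nth f (n - i))"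
    by (simp add: power2_eq_square fps_mult_nth)
  also have "\<dots> = (\<Sum>i \<in> {i \<in> {0..n}. n - i = i}. fps_nth f i * fps_nth f (n - i))"
    by (rule sum_bit_involution) (auto simp: mult.commute)
  also have "{i \<in> {0..n}. n - i = i} = (if even n then {n div 2} else {})"
    by (auto elim!: evenE) presburger
  also have "(\<Sum>i \<in> (if even n then {n div 2} else {}). fps_nth f i * fps_nth f (n - i))
      = (if even n then fps_nth f (n div 2) else 0)"
    by (cases "fps_nth f (n div 2)") (auto elim!: evenE)
  finally show ?thesis .
qed

lemma bit_fps_square_add: "(f + g) ^ 2 = f ^ 2 + g ^ 2" for f g :: "bit fps"
  by (rule fps_ext) (simp add: bit_fps_square_nth)

lemma q_poch_inf_square:
  fixes a q :: "bit fps"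
  assumes "fps_nth a 0 = 0" "fps_nth q 0 = 0"
  shows "q_poch_inf (a ^ 2) (q ^ 2) = q_poch_inf a q ^ 2"
proof (rule fps_eqI_agree)
  fix m
  have "1 - a ^ 2 * (q ^ 2) ^ j = (1 - a * q ^ j) ^ 2" for j
    using bit_fps_square_add[of 1 "a * q ^ j"]
    by (simp only: diff_conv_add_uminus uminus_bit_fps)
       (simp add: power_mult_distrib power_mult [symmetric] mult.commute)
  then have eq: "q_poch (a ^ 2) (q ^ 2) n = q_poch a q n ^ 2" for n
    by (simp add: q_poch_def prod_power_distrib)
  have "fps_agree m (q_poch_inf a q ^ 2) (q_poch a q (Suc m) ^ 2)"
    unfolding power2_eq_square using assms by (intro fps_agree_mult q_poch_inf_agree) auto
  moreover have "fps_agree m (q_poch_inf (a ^ 2) (q ^ 2)) (q_poch a q (Suc m) ^ 2)"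
    unfolding eq [symmetric] using assms by (intro q_poch_inf_agree) (auto simp: fps_power_zeroth)
  ultimately show "\<exists>h. fps_agree m (q_poch_inf (a ^ 2) (q ^ 2)) h \<and>
      fps_agree m (q_poch_inf a q ^ 2) h" by blast
qed

lemma q_poch_inf_compose_X_power:
  assumes "d > 0"
  shows "q_poch_inf (fps_X ^ d) (fps_X ^ d) = (q_poch_inf fps_X fps_X :: 'a::idom fps) oo fps_X ^ d"
proof (rule fps_ext)
  fix m
  have d0: "fps_nth (fps_X ^ d :: 'a fps) 0 = 0" using assms by simp
  have eq: "q_poch (fps_X ^ d) (fps_X ^ d) n = (q_poch fps_X fps_X n :: 'a fps) oo fps_X ^ d" for n
    by (simp add: q_poch_def fps_compose_prod_distrib[OF d0] fps_compose_sub_distrib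
        fps_compose_mult_distrib[OF d0] fps_compose_power[OF d0, symmetric]
        fps_X_fps_compose_startby0[OF d0])
  have "fps_nth (q_poch_inf (fps_X ^ d) (fps_X ^ d) :: 'a fps) m
      = fps_nth (q_poch (fps_X ^ d) (fps_X ^ d) (Suc m) :: 'a fps) m"
    using q_poch_inf_agree[of "fps_X ^ d :: 'a fps" "fps_X ^ d" m "Suc m"] assms
    by (simp add: fps_agree_def)
  also have "\<dots> = fps_nth ((q_poch_inf fps_X fps_X :: 'a fps) oo fps_X ^ d) m"
    unfolding eq fps_nth_compose_X_power
    using q_poch_inf_agree[of "fps_X :: 'a fps" fps_X m "Suc m"]
    by (simp add: fps_agree_def)
  finally show "fps_nth (q_poch_inf (fps_X ^ d) (fps_X ^ d) :: 'a fps) m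
      = fps_nth ((q_poch_inf fps_X fps_X :: 'a fps) oo fps_X ^ d) m" .
qed

definition phi :: "bit fps" where "phi = q_poch_inf fps_X fps_X"
definition phi5 :: "bit fps" where "phi5 = q_poch_inf (fps_X ^ 5) (fps_X ^ 5)"

lemma phi5_conv_phi: "phi5 = phi oo fps_X ^ 5"
  unfolding phi_def phi5_def by (rule q_poch_inf_compose_X_power) simp

definition theta :: "nat \<Rightarrow> nat \<Rightarrow> bit fps" where
  "theta r s = Abs_fps (\<lambda>m. of_nat (card {k. theta_exp r s k = m}))"

lemma theta_product:
  assumes "r > 0" "s > 0"
  shows "theta r s = q_poch_inf (fps_X ^ r) (fps_X ^ (r + s)) *
    q_poch_inf (fps_X ^ s) (fps_X ^ (r + s)) * q_poch_inf (fps_X ^ (r + s)) (fps_X ^ (r + s))"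
  using jacobi_triple_product[OF assms refl refl refl, where 'a = bit]
  by (simp add: theta_def)

lemma phi_eq_theta: "phi = theta 1 2"
proof -
  have "phi = (\<Prod>i<3. q_poch_inf (fps_X * fps_X ^ i) (fps_X ^ 3))"
    unfolding phi_def by (rule q_poch_inf_section) auto
  also have "\<dots> = theta 1 2"
    by (subst theta_product) (simp_all add: lessThan_nat_numeral lessThan_Suc numeral_3_eq_3 numeral_2_eq_2 mult_ac)
  finally show ?thesis .
qed

text \<open>
  Here \<open>\<psi>(q) = f(q, q\<^sup>3) = (-q; q\<^sup>4)\<^sub>\<infinity> (-q\<^sup>3; q\<^sup>4)\<^sub>\<infinity> (q\<^sup>4; q\<^sup>4)\<^sub>\<infinity>\<close>. Modulo 2 the first two factors
  combine to \<open>(q; q\<^sup>2)\<^sub>\<infinity> = phi / phi\<^sup>2\<close>, and the third is \<open>phi\<^sup>4\<close>.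
\<close>

lemma phi_cube_eq_theta: "phi ^ 3 = theta 1 3"
proof -
  have s2: "phi = q_poch_inf fps_X (fps_X ^ 2) * q_poch_inf (fps_X ^ 2) (fps_X ^ 2)"
    unfolding phi_def using q_poch_inf_section[of "fps_X :: bit fps" fps_X 2]
    by (simp add: numeral_2_eq_2 lessThan_Suc mult_ac)
  have s4: "q_poch_inf fps_X (fps_X ^ 2)
      = q_poch_inf fps_X (fps_X ^ 4) * (q_poch_inf (fps_X ^ 3) (fps_X ^ 4) :: bit fps)"
    using q_poch_inf_section[of "fps_X :: bit fps" "fps_X ^ 2" 2]
    by (simp add: lessThan_nat_numeral lessThan_Suc mult_ac flip: power_mult power_Suc)
  have p2: "q_poch_inf (fps_X ^ 2) (fps_X ^ 2) = phi ^ 2"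
    unfolding phi_def by (rule q_poch_inf_square) auto
  have p4: "q_poch_inf (fps_X ^ 4) (fps_X ^ 4) = (phi ^ 2) ^ 2"
    unfolding p2 [symmetric] using q_poch_inf_square[of "fps_X ^ 2" "fps_X ^ 2"]
    by (simp add: power_mult [symmetric])
  have "theta 1 3 = q_poch_inf fps_X (fps_X ^ 2) * (phi ^ 2) ^ 2"
    by (subst theta_product) (simp_all add: s4 p4)
  also have "\<dots> = (q_poch_inf fps_X (fps_X ^ 2) * phi ^ 2) * phi ^ 2"
    by (simp add: power2_eq_square mult_ac)
  also have "\<dots> = phi ^ 3"
    using s2 p2 by (simp add: power2_eq_square power3_eq_cube mult_ac)
  finally show ?thesis by simp
qed

text \<open>
  The four products modulo \<open>q\<^sup>5\<close> in the two triple products, together with one factor \<open>phi5\<close>, make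
  up \<open>phi\<close>; the other factor \<open>phi5\<close> remains.
\<close>

lemma phi_mult_phi5_eq_theta: "phi * phi5 = theta 1 4 * theta 2 3"
proof -
  have X: "fps_X * fps_X = (fps_X ^ 2 :: bit fps)" "fps_X * fps_X ^ 2 = (fps_X ^ 3 :: bit fps)"
      "fps_X * fps_X ^ 3 = (fps_X ^ 4 :: bit fps)" "fps_X * fps_X ^ 4 = (fps_X ^ 5 :: bit fps)"
    by (rule power2_eq_square [symmetric]) (simp_all flip: power_Suc)
  have five: "{..<5} = {0, 1, 2, 3, 4 :: nat}" by auto
  have "phi = (\<Prod>i<5. q_poch_inf (fps_X * fps_X ^ i) (fps_X ^ 5))"
    unfolding phi_def by (rule q_poch_inf_section) auto
  also have "\<dots> = q_poch_inf fps_X (fps_X ^ 5) * q_poch_inf (fps_X ^ 2) (fps_X ^ 5) *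
      q_poch_inf (fps_X ^ 3) (fps_X ^ 5) * q_poch_inf (fps_X ^ 4) (fps_X ^ 5) * phi5"
    unfolding five by (simp add: phi5_def X mult_ac)
  finally show ?thesis
    by (simp add: theta_product phi5_def mult_ac)
qed

section \<open>Coefficients of Euler products modulo 2\<close>

lemma card_fibre_eq_of_bool:
  assumes "\<And>k l. f k = f l \<Longrightarrow> k = l"
  shows "card {k. f k = m} = of_bool (\<exists>k. f k = m)"
proof (cases "\<exists>k. f k = m")
  case True
  then obtain k where "f k = m" by blast
  then have "{k. f k = m} = {k}" using assms by auto
  with True show ?thesis by simp
qed simp

lemma pentagonal_square_iff:
  "(\<exists>k::int. 3 * k ^ 2 - k = 2 * int m) \<longleftrightarrow> (\<exists>x::int. x ^ 2 = 24 * int m + 1)"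
proof
  assume "\<exists>k::int. 3 * k ^ 2 - k = 2 * int m"
  then obtain k :: int where "3 * k ^ 2 - k = 2 * int m" by blast
  then have "(6 * k - 1) ^ 2 = 24 * int m + 1"
    by (simp add: power2_eq_square algebra_simps)
  then show "\<exists>x::int. x ^ 2 = 24 * int m + 1" by blast
next
  assume "\<exists>x::int. x ^ 2 = 24 * int m + 1"
  then obtain x :: int where x: "x ^ 2 = 24 * int m + 1" by blast
  have "x mod 6 = 1 \<or> x mod 6 = 5"
  proof -
    have "x ^ 2 mod 6 = 1" unfolding x by presburger
    then have "(x mod 6) ^ 2 mod 6 = 1" by (simp add: power_mod)
    moreover have "x mod 6 \<in> {0, 1, 2, 3, 4, 5}" by simp presburger
    ultimately show ?thesis by auto
  qed
  then have "\<exists>k. x = 6 * k - 1 \<or> - x = 6 * k - 1" by presburger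
  then obtain k where "x = 6 * k - 1 \<or> - x = 6 * k - 1" by blast
  then have "x ^ 2 = (6 * k - 1) ^ 2" by (metis power2_minus)
  with x have "3 * k ^ 2 - k = 2 * int m"
    by (simp add: power2_eq_square algebra_simps)
  then show "\<exists>k::int. 3 * k ^ 2 - k = 2 * int m" by blast
qed

text \<open>
  The pentagonal number theorem modulo 2.
\<close>

lemma phi_nth: "fps_nth phi m = of_bool (\<exists>x::int. x ^ 2 = 24 * int m + 1)"
proof -
  have e: "2 * int (theta_exp 1 2 k) = 3 * k ^ 2 - k" for k
    unfolding two_times_theta_exp by (simp add: power2_eq_square algebra_simps)
  have inj: "k = l" if "theta_exp 1 2 k = theta_exp 1 2 l" for k l
  proof -
    have "(k - l) * (3 * (k + l) - 1) = 0"
      using e[of k] e[of l] that by (simp add: power2_eq_square algebra_simps)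
    moreover have "3 * (k + l) - 1 \<noteq> 0" by presburger
    ultimately show ?thesis by simp
  qed
  have "theta_exp 1 2 k = m \<longleftrightarrow> 3 * k ^ 2 - k = 2 * int m" for k
    using e[of k] by linarith
  then show ?thesis
    by (simp add: phi_eq_theta theta_def card_fibre_eq_of_bool[OF inj] pentagonal_square_iff)
qed

lemma odd_square_mod_8:
  assumes "odd (x::int)"
  shows "\<exists>j::nat. x ^ 2 = 8 * int j + 1"
proof -
  obtain k where "x = 2 * k + 1" using assms by (elim oddE)
  then have x: "x ^ 2 = 4 * (k * (k + 1)) + 1"
    by (simp add: power2_eq_square algebra_simps)
  have "even (k * (k + 1))" by simp
  then obtain j where j: "k * (k + 1) = 2 * j" by (elim evenE)
  have "j \<ge> 0" using x j zero_le_power2[of x] by linarith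
  then show ?thesis using x j by (intro exI[of _ "nat j"]) simp
qed

lemma triangular_square_iff:
  "(\<exists>k::int. 2 * k ^ 2 - k = int m) \<longleftrightarrow> (\<exists>x::int. x ^ 2 = 8 * int m + 1)"
proof
  assume "\<exists>k::int. 2 * k ^ 2 - k = int m"
  then obtain k :: int where "2 * k ^ 2 - k = int m" by blast
  then have "(4 * k - 1) ^ 2 = 8 * int m + 1"
    by (simp add: power2_eq_square algebra_simps)
  then show "\<exists>x::int. x ^ 2 = 8 * int m + 1" by blast
next
  assume "\<exists>x::int. x ^ 2 = 8 * int m + 1"
  then obtain x :: int where x: "x ^ 2 = 8 * int m + 1" by blast
  then have "odd (x ^ 2)" by simp
  then have "odd x" by simp
  then have "\<exists>k. x = 4 * k - 1 \<or> - x = 4 * k - 1" by presburger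
  then obtain k where "x = 4 * k - 1 \<or> - x = 4 * k - 1" by blast
  then have "x ^ 2 = (4 * k - 1) ^ 2" by (metis power2_minus)
  with x have "2 * k ^ 2 - k = int m"
    by (simp add: power2_eq_square algebra_simps)
  then show "\<exists>k::int. 2 * k ^ 2 - k = int m" by blast
qed

text \<open>
  Modulo 2, Jacobi's identity for the cube of the Euler product: the support is the set of triangular
  numbers.
\<close>

lemma phi_cube_nth: "fps_nth (phi ^ 3) m = of_bool (\<exists>x::int. x ^ 2 = 8 * int m + 1)"
proof -
  have e: "int (theta_exp 1 3 k) = 2 * k ^ 2 - k" for k
    using two_times_theta_exp[of 1 3 k] by (simp add: power2_eq_square algebra_simps)
  have inj: "k = l" if "theta_exp 1 3 k = theta_exp 1 3 l" for k l
  proof -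
    have "(k - l) * (2 * (k + l) - 1) = 0"
      using e[of k] e[of l] that by (simp add: power2_eq_square algebra_simps)
    moreover have "2 * (k + l) - 1 \<noteq> 0" by presburger
    ultimately show ?thesis by simp
  qed
  have "theta_exp 1 3 k = m \<longleftrightarrow> 2 * k ^ 2 - k = int m" for k
    using e[of k] by linarith
  then show ?thesis
    by (simp add: phi_cube_eq_theta theta_def card_fibre_eq_of_bool[OF inj] triangular_square_iff)
qed

lemma finite_theta_exp_fibre:
  assumes "r > 0" "s > 0"
  shows "finite {k. theta_exp r s k = m}"
proof (rule finite_subset)
  show "{k. theta_exp r s k = m} \<subseteq> {- int m..int m}"
  proof
    fix k assume "k \<in> {k. theta_exp r s k = m}"
    then have "\<bar>k\<bar> \<le> int m" using abs_le_theta_exp[OF assms, of k] by simp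
    then show "k \<in> {- int m..int m}" by (simp add: abs_le_iff)
  qed
qed simp

lemma theta_mult_nth:
  assumes "r > 0" "s > 0" "r' > 0" "s' > 0"
  shows "fps_nth (theta r s * theta r' s') n
       = of_nat (card {(k, l). theta_exp r s k + theta_exp r' s' l = n})"
proof -
  define A where "A i = {k. theta_exp r s k = i} \<times> {l. theta_exp r' s' l = n - i}" for i
  have fin: "finite (A i)" for i
    using assms by (simp add: A_def finite_theta_exp_fibre)
  have "{(k, l). theta_exp r s k + theta_exp r' s' l = n} = (\<Union>i\<in>{0..n}. A i)"
    by (auto simp: A_def)
  also have "card \<dots> = (\<Sum>i = 0..n. card (A i))"
    using fin by (intro card_UN_disjoint) (auto simp: A_def)
  finally have "card {(k, l). theta_exp r s k + theta_exp r' s' l = n} = (\<Sum>i = 0..n. card (A i))" .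
  then show ?thesis
    by (simp add: fps_mult_nth theta_def A_def card_cartesian_product)
qed

section \<open>Sums of two odd squares and the relation between the two Euler products\<close>

text \<open>
  The factor \<open>c\<close> treats representations of \<open>n\<close> and of \<open>n / 5\<close> alike: for \<open>c = 5\<close> the set is empty
  unless 5 divides \<open>n\<close>.
\<close>

definition odd_reps :: "int \<Rightarrow> int \<Rightarrow> (int \<times> int) set" where
  "odd_reps c n = {(a, b). odd a \<and> odd b \<and> c * (a ^ 2 + b ^ 2) = n}"

lemma finite_odd_reps:
  assumes "c > 0"
  shows "finite (odd_reps c n)"
proof (rule finite_subset)
  show "odd_reps c n \<subseteq> {-n..n} \<times> {-n..n}"
  proof
    fix z assume "z \<in> odd_reps c n"
    then obtain a b where z: "z = (a, b)" "odd a" "odd b" "c * (a ^ 2 + b ^ 2) = n"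
      by (auto simp: odd_reps_def)
    have "1 * (a ^ 2 + b ^ 2) \<le> n"
      unfolding z(4) [symmetric] using assms by (intro mult_right_mono) auto
    moreover have "\<bar>a\<bar> \<le> a ^ 2" "\<bar>b\<bar> \<le> b ^ 2"
      using self_le_power[of "\<bar>a\<bar>" 2] self_le_power[of "\<bar>b\<bar>" 2] z by (cases "a = 0"; cases "b = 0"; simp)+
    ultimately show "z \<in> {-n..n} \<times> {-n..n}"
      using z(1) zero_le_power2[of a] zero_le_power2[of b] by auto
  qed
qed simp

definition pos_odd_reps :: "int \<Rightarrow> int \<Rightarrow> (int \<times> int) set" where
  "pos_odd_reps c n = {(a, b) \<in> odd_reps c n. a > 0 \<and> b > 0}"

text \<open>
  The four choices of signs; odd numbers are never 0, so these are always different pairs.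
\<close>

lemma card_odd_reps:
  assumes "c > 0"
  shows "card (odd_reps c n) = 4 * card (pos_odd_reps c n)"
proof -
  let ?P = "pos_odd_reps c n"
  define f :: "int \<times> int \<Rightarrow> int \<times> int \<Rightarrow> int \<times> int"
    where "f = (\<lambda>(s, t) (a, b). (s * a, t * b))"
  have split: "odd_reps c n = (\<Union>u\<in>{1, -1} \<times> {1, -1}. f u ` ?P)"
  proof (intro equalityI subsetI)
    fix z assume "z \<in> odd_reps c n"
    then obtain a b where z: "z = (a, b)" "odd a" "odd b" "c * (a ^ 2 + b ^ 2) = n"
      by (auto simp: odd_reps_def)
    then have "(\<bar>a\<bar>, \<bar>b\<bar>) \<in> ?P" by (auto simp: pos_odd_reps_def odd_reps_def)
    moreover have "f (sgn a, sgn b) (\<bar>a\<bar>, \<bar>b\<bar>) = z"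
      by (simp add: f_def z mult_sgn_abs)
    moreover have "(sgn a, sgn b) \<in> {1, -1} \<times> {1, -1}"
      using z by (auto simp: sgn_if)
    ultimately show "z \<in> (\<Union>u\<in>{1, -1} \<times> {1, -1}. f u ` ?P)" by blast
  qed (auto simp: f_def pos_odd_reps_def odd_reps_def)
  have fin: "finite ?P"
    by (rule finite_subset[OF _ finite_odd_reps[OF assms]]) (auto simp: pos_odd_reps_def)
  have "card (odd_reps c n) = (\<Sum>u\<in>{1, -1} \<times> {1, -1}. card (f u ` ?P))"
    unfolding split using fin
    by (intro card_UN_disjoint) (auto simp: f_def pos_odd_reps_def)
  also have "\<dots> = (\<Sum>u\<in>{1, -1 :: int} \<times> {1, -1 :: int}. card ?P)"
    by (intro sum.cong refl card_image) (auto simp: f_def inj_on_def)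
  finally show ?thesis by (simp add: card_cartesian_product)
qed

text \<open>
  Exchanging the coordinates is an involution whose fixed points are the pairs \<open>(t, t)\<close>.
\<close>

lemma parity_pos_odd_reps:
  assumes "c > 0"
  shows "(of_nat (card (pos_odd_reps c n)) :: bit) = of_bool (\<exists>t. odd t \<and> 2 * c * t ^ 2 = n)"
proof -
  let ?P = "pos_odd_reps c n"
  have fin: "finite ?P"
    by (rule finite_subset[OF _ finite_odd_reps[OF assms]]) (auto simp: pos_odd_reps_def)
  have double: "c * (t ^ 2 + t ^ 2) = 2 * c * t ^ 2" for t by simp
  have "(of_nat (card ?P) :: bit) = (\<Sum>z\<in>?P. 1)" by simp
  also have "\<dots> = (\<Sum>z\<in>{z \<in> ?P. prod.swap z = z}. 1)"
    using fin by (intro sum_bit_involution) (auto simp: pos_odd_reps_def odd_reps_def add.commute)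
  also have "\<dots> = of_nat (card {z \<in> ?P. prod.swap z = z})" by simp
  also have "{z \<in> ?P. prod.swap z = z} = (\<lambda>t. (t, t)) ` {t. odd t \<and> 0 < t \<and> 2 * c * t ^ 2 = n}"
  proof (intro equalityI subsetI)
    fix z assume "z \<in> {z \<in> ?P. prod.swap z = z}"
    then have swap: "prod.swap z = z" and P: "z \<in> ?P" by simp_all
    obtain t u where z: "z = (t, u)" by (cases z)
    have tu: "u = t" using arg_cong[OF swap, of fst] by (simp add: z)
    with P have "odd t" "0 < t" "2 * c * t ^ 2 = n"
      using double[of t] by (simp_all add: z pos_odd_reps_def odd_reps_def)
    then show "z \<in> (\<lambda>t. (t, t)) ` {t. odd t \<and> 0 < t \<and> 2 * c * t ^ 2 = n}"
      unfolding z tu by blast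
  next
    fix z assume "z \<in> (\<lambda>t. (t, t)) ` {t. odd t \<and> 0 < t \<and> 2 * c * t ^ 2 = n}"
    then obtain t where "z = (t, t)" "odd t" "0 < t" "2 * c * t ^ 2 = n" by blast
    then show "z \<in> {z \<in> ?P. prod.swap z = z}"
      using double[of t] by (simp add: pos_odd_reps_def odd_reps_def)
  qed
  also have "card \<dots> = card {t. odd t \<and> 0 < t \<and> 2 * c * t ^ 2 = n}"
    by (intro card_image) (auto simp: inj_on_def)
  also have "\<dots> = of_bool (\<exists>t. odd t \<and> 2 * c * t ^ 2 = n)"
  proof (cases "\<exists>t. odd t \<and> 2 * c * t ^ 2 = n")
    case True
    then obtain t where t: "odd t" "2 * c * t ^ 2 = n" by blast
    have "u = \<bar>t\<bar>" if "0 < u" "2 * c * u ^ 2 = n" for u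
    proof -
      have "2 * c * u ^ 2 = 2 * c * t ^ 2" using that t by simp
      with assms have "u ^ 2 = t ^ 2" by simp
      then have "u = t \<or> u = - t" by (simp add: power2_eq_iff)
      then show ?thesis using that(1) by auto
    qed
    moreover have "t \<noteq> 0" using t by auto
    ultimately have "{t. odd t \<and> 0 < t \<and> 2 * c * t ^ 2 = n} = {\<bar>t\<bar>}"
      using t by auto
    with True show ?thesis by simp
  next
    case False
    then have "{t. odd t \<and> 0 < t \<and> 2 * c * t ^ 2 = n} = {}" by blast
    with False show ?thesis by (simp only: card.empty of_bool_eq)
  qed
  finally show ?thesis by simp
qed

text \<open>
  If \<open>x\<^sup>2 + y\<^sup>2\<close> is divisible by 5, then \<open>x \<equiv> \<plusminus>2 y\<close> modulo 5. The sign chosen here means that \<open>x + i y\<close> is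
  divisible by the Gaussian prime \<open>1 + 2 i\<close>. The pairs are sorted by the residue of \<open>y\<close>: residue
  4 describes the pairs in the theta product, residue 0 the multiples of 5.
\<close>

definition aligned :: "int \<Rightarrow> int \<Rightarrow> (int \<times> int) set" where
  "aligned c n = {(x, y) \<in> odd_reps 1 (5 * n). [x = 3 * y] (mod 5) \<and> y mod 5 = c}"

text \<open>
  Multiplication by \<open>1 + 2 i\<close>, which sends \<open>a + i b\<close> to \<open>(a - 2 b) + i (2 a + b)\<close> and multiplies norms by 5.
\<close>

lemma card_odd_reps_times_5:
  "card (odd_reps 1 n) = card {(x, y) \<in> odd_reps 1 (5 * n). [x = 3 * y] (mod 5)}"
proof (rule bij_betw_same_card, rule bij_betwI)
  show "(\<lambda>(a, b). (a - 2 * b, 2 * a + b)) \<in> odd_reps 1 n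
      \<rightarrow> {(x, y) \<in> odd_reps 1 (5 * n). [x = 3 * y] (mod 5)}"
    by (auto simp: odd_reps_def power2_eq_square algebra_simps cong_iff_dvd_diff)
  show "(\<lambda>(x, y). ((x + 2 * y) div 5, (y - 2 * x) div 5))
      \<in> {(x, y) \<in> odd_reps 1 (5 * n). [x = 3 * y] (mod 5)} \<rightarrow> odd_reps 1 n"
  proof (clarify)
    fix x y assume xy: "(x, y) \<in> odd_reps 1 (5 * n)" "[x = 3 * y] (mod 5)"
    have "5 dvd x - 3 * y" using xy(2) by (simp add: cong_iff_dvd_diff)
    then obtain k where k: "x - 3 * y = 5 * k" by (elim dvdE)
    have "x + 2 * y = 5 * (k + y)" "y - 2 * x = 5 * (- 2 * k - y)"
      using k by simp_all
    then have d: "(x + 2 * y) div 5 = k + y" "(y - 2 * x) div 5 = - 2 * k - y"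
      by simp_all
    have x: "x = 5 * k + 3 * y" using k by simp
    have "odd (k + y)" "odd (- 2 * k - y)"
      using xy(1) x by (auto simp: odd_reps_def)
    moreover have "5 * ((k + y) ^ 2 + (- 2 * k - y) ^ 2) = 5 * n"
      using xy(1) unfolding x by (simp add: odd_reps_def power2_eq_square algebra_simps)
    then have "(k + y) ^ 2 + (- 2 * k - y) ^ 2 = n" by simp
    ultimately show "((x + 2 * y) div 5, (y - 2 * x) div 5) \<in> odd_reps 1 n"
      unfolding d by (simp add: odd_reps_def)
  qed
  show "(\<lambda>(x, y). ((x + 2 * y) div 5, (y - 2 * x) div 5)) ((\<lambda>(a, b). (a - 2 * b, 2 * a + b)) z) = z"
    for z :: "int \<times> int"
    by (cases z) simp
  show "(\<lambda>(a, b). (a - 2 * b, 2 * a + b)) ((\<lambda>(x, y). ((x + 2 * y) div 5, (y - 2 * x) div 5)) z) = z"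
    if "z \<in> {(x, y) \<in> odd_reps 1 (5 * n). [x = 3 * y] (mod 5)}" for z
  proof -
    obtain x y where z: "z = (x, y)" by (cases z)
    with that have "5 dvd x - 3 * y" by (simp add: cong_iff_dvd_diff)
    then obtain k where k: "x - 3 * y = 5 * k" by (elim dvdE)
    have "x + 2 * y = 5 * (k + y)" "y - 2 * x = 5 * (- 2 * k - y)"
      using k by simp_all
    then have "(x + 2 * y) div 5 = k + y" "(y - 2 * x) div 5 = - 2 * k - y"
      by simp_all
    then show ?thesis using z k by simp
  qed
qed

lemma finite_aligned: "finite (aligned c n)"
  by (rule finite_subset[OF _ finite_odd_reps[of 1 "5 * n"]]) (auto simp: aligned_def)

text \<open>
  Multiplication by \<open>i\<close>. As 3 generates the units modulo 5, going round its cycle 4, 2, 1, 3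
  shows that the four nonzero classes have equally many elements.
\<close>

lemma card_aligned_rotate: "card (aligned c n) \<le> card (aligned (3 * c mod 5) n)"
proof (rule card_inj_on_le)
  show "inj_on (\<lambda>(x, y). (- y, x)) (aligned c n)"
    by (auto simp: inj_on_def)
  show "(\<lambda>(x, y). (- y, x)) ` aligned c n \<subseteq> aligned (3 * c mod 5) n"
  proof clarify
    fix x y assume xy: "(x, y) \<in> aligned c n"
    then have m: "x mod 5 = 3 * y mod 5" and c: "c = y mod 5"
      by (auto simp: aligned_def cong_def)
    from m have "5 dvd x - 3 * y" by (simp add: mod_eq_dvd_iff)
    then obtain k where "x - 3 * y = 5 * k" by (elim dvdE)
    then have "- y - 3 * x = 5 * (- 3 * k - 2 * y)" by simp
    then have "- y mod 5 = 3 * x mod 5" by (metis dvd_triv_left mod_eq_dvd_iff)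
    moreover from m have "x mod 5 = 3 * c mod 5" by (simp add: c mod_mult_right_eq)
    ultimately show "(- y, x) \<in> aligned (3 * c mod 5) n"
      using xy by (simp add: aligned_def odd_reps_def cong_def add.commute)
  qed
qed (rule finite_aligned)

lemma card_aligned_0: "card (aligned 0 n) = card (odd_reps 5 n)"
proof (rule bij_betw_same_card, rule bij_betwI)
  show "(\<lambda>(x, y). (x div 5, y div 5)) \<in> aligned 0 n \<rightarrow> odd_reps 5 n"
  proof clarify
    fix x y assume xy: "(x, y) \<in> aligned 0 n"
    then have "x mod 5 = 3 * y mod 5" "y mod 5 = 0" by (auto simp: aligned_def cong_def)
    then have "5 dvd y" "5 dvd 3 * y" "x mod 5 = 3 * y mod 5" by auto
    then have "5 dvd x" "5 dvd y" by auto
    then obtain u v where "x = 5 * u" "y = 5 * v" by (elim dvdE)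
    then show "(x div 5, y div 5) \<in> odd_reps 5 n"
      using xy by (auto simp: aligned_def odd_reps_def power2_eq_square)
  qed
  show "(\<lambda>(x, y). (5 * x, 5 * y)) \<in> odd_reps 5 n \<rightarrow> aligned 0 n"
    by (auto simp: aligned_def odd_reps_def power2_eq_square cong_def algebra_simps)
  show "(\<lambda>(x, y). (5 * x, 5 * y)) ((\<lambda>(x, y). (x div 5, y div 5)) z) = z" if "z \<in> aligned 0 n" for z
  proof -
    obtain x y where z: "z = (x, y)" by (cases z)
    with that have "x mod 5 = 3 * y mod 5" "y mod 5 = 0" by (auto simp: aligned_def cong_def)
    then have "5 dvd y" "5 dvd 3 * y" "x mod 5 = 3 * y mod 5" by auto
    then have "5 dvd x" "5 dvd y" by auto
    then show ?thesis by (simp add: z)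
  qed
qed auto

lemma card_odd_reps_decompose:
  "card (odd_reps 1 n) = 4 * card (aligned 4 n) + card (odd_reps 5 n)"
proof -
  have "{(x, y) \<in> odd_reps 1 (5 * n). [x = 3 * y] (mod 5)} = (\<Union>c\<in>{0,1,2,3,4}. aligned c n)"
  proof -
    have "y mod 5 \<in> {0, 1, 2, 3, 4}" for y :: int by simp presburger
    then show ?thesis by (auto simp: aligned_def)
  qed
  also have "card \<dots> = (\<Sum>c\<in>{0,1,2,3,4}. card (aligned c n))"
    using finite_aligned by (intro card_UN_disjoint) (auto simp: aligned_def)
  also have "\<dots> = 4 * card (aligned 4 n) + card (odd_reps 5 n)"
    using card_aligned_rotate[of 4 n] card_aligned_rotate[of 2 n] card_aligned_rotate[of 1 n]
      card_aligned_rotate[of 3 n]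
    by (simp add: card_aligned_0)
  finally show ?thesis by (simp add: card_odd_reps_times_5)
qed

text \<open>
  Completing the square in both theta exponents, with \<open>x = 10 k - 3\<close> and \<open>y = 10 l - 1\<close>. Among
  the odd numbers these are given by \<open>y \<equiv> 4\<close> and \<open>x \<equiv> 3 y \<equiv> 2\<close> modulo 5.
\<close>

lemma card_theta_pairs:
  "card {(k, l). theta_exp 1 4 k + theta_exp 2 3 l = n} = card (aligned 4 (8 * int n + 2))"
proof (rule bij_betw_same_card, rule bij_betwI)
  have iff: "theta_exp 1 4 k + theta_exp 2 3 l = n
      \<longleftrightarrow> (10 * k - 3) ^ 2 + (10 * l - 1) ^ 2 = 5 * (8 * int n + 2)" for k l
  proof -
    have e: "2 * int (theta_exp 1 4 k) = 5 * k ^ 2 - 3 * k" "2 * int (theta_exp 2 3 l) = 5 * l ^ 2 - l"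
      unfolding two_times_theta_exp by (simp_all add: power2_eq_square algebra_simps)
    have sq: "(10 * k - 3) ^ 2 + (10 * l - 1) ^ 2
        = 20 * (5 * k ^ 2 - 3 * k) + 20 * (5 * l ^ 2 - l) + 10"
      by (simp add: power2_eq_square algebra_simps)
    have a: "theta_exp 1 4 k + theta_exp 2 3 l = n
        \<longleftrightarrow> 2 * int (theta_exp 1 4 k) + 2 * int (theta_exp 2 3 l) = 2 * int n" by linarith
    have "u + v = 2 * w \<longleftrightarrow> 20 * u + 20 * v + 10 = 5 * (8 * w + 2)" for u v w :: int
      by presburger
    then show ?thesis unfolding a e sq .
  qed
  show "(\<lambda>(k, l). (10 * k - 3, 10 * l - 1)) \<in> {(k, l). theta_exp 1 4 k + theta_exp 2 3 l = n}
      \<rightarrow> aligned 4 (8 * int n + 2)"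
  proof
    fix z assume "z \<in> {(k, l). theta_exp 1 4 k + theta_exp 2 3 l = n}"
    then obtain k l where z: "z = (k, l)" and kl: "theta_exp 1 4 k + theta_exp 2 3 l = n" by blast
    have "(10 * k - 3) mod 5 = 3 * (10 * l - 1) mod 5" "(10 * l - 1) mod 5 = 4"
      by presburger+
    with kl show "(\<lambda>(k, l). (10 * k - 3, 10 * l - 1)) z \<in> aligned 4 (8 * int n + 2)"
      unfolding iff z by (simp add: aligned_def odd_reps_def cong_def)
  qed
  have recover: "10 * ((x + 3) div 10) - 3 = x" "10 * ((y + 1) div 10) - 1 = y"
    if "(x, y) \<in> aligned 4 (8 * int n + 2)" for x y
  proof -
    have x: "odd x" and y: "odd y" "y mod 5 = 4" and xy: "x mod 5 = 3 * y mod 5"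
      using that by (auto simp: aligned_def odd_reps_def cong_def)
    have "x mod 5 = 2"
      using mod_mult_right_eq[of 3 y 5] xy y(2) by simp
    with x have "10 dvd x + 3" by presburger
    then show "10 * ((x + 3) div 10) - 3 = x" by simp
    from y have "10 dvd y + 1" by presburger
    then show "10 * ((y + 1) div 10) - 1 = y" by simp
  qed
  show "(\<lambda>(x, y). ((x + 3) div 10, (y + 1) div 10)) \<in> aligned 4 (8 * int n + 2)
      \<rightarrow> {(k, l). theta_exp 1 4 k + theta_exp 2 3 l = n}"
  proof clarify
    fix x y assume xy: "(x, y) \<in> aligned 4 (8 * int n + 2)"
    then show "theta_exp 1 4 ((x + 3) div 10) + theta_exp 2 3 ((y + 1) div 10) = n"
      unfolding iff recover[OF xy] by (simp add: aligned_def odd_reps_def)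
  qed
  show "(\<lambda>(k, l). (10 * k - 3, 10 * l - 1)) ((\<lambda>(x, y). ((x + 3) div 10, (y + 1) div 10)) z) = z"
    if "z \<in> aligned 4 (8 * int n + 2)" for z
    using recover that by (cases z) simp
qed auto

text \<open>
  Dividing \<open>card_odd_reps_decompose\<close> by 4 expresses the number of theta pairs by numbers of positive
  representations, whose parity is known.
\<close>

lemma phi_mult_phi5_nth:
  "fps_nth (phi * phi5) n
     = of_bool (\<exists>t::int. t ^ 2 = 4 * int n + 1) + of_bool (\<exists>t::int. 5 * t ^ 2 = 4 * int n + 1)"
proof -
  define m where "m = 8 * int n + 2"
  have "card (pos_odd_reps 1 m) = card (aligned 4 m) + card (pos_odd_reps 5 m)"
    using card_odd_reps_decompose[of m] card_odd_reps[of 1 m] card_odd_reps[of 5 m] by simp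
  then have "of_nat (card (pos_odd_reps 1 m)) =
      (of_nat (card (aligned 4 m)) + of_nat (card (pos_odd_reps 5 m)) :: bit)" by simp
  moreover have "fps_nth (phi * phi5) n = of_nat (card (aligned 4 m))"
    by (simp add: phi_mult_phi5_eq_theta theta_mult_nth card_theta_pairs [simplified] m_def)
  ultimately have "fps_nth (phi * phi5) n
      = of_nat (card (pos_odd_reps 1 m)) + of_nat (card (pos_odd_reps 5 m))"
    by (cases "of_nat (card (pos_odd_reps 5 m)) :: bit") simp_all
  moreover have "(\<exists>t. odd t \<and> 2 * 1 * t ^ 2 = m) \<longleftrightarrow> (\<exists>t. t ^ 2 = 4 * int n + 1)"
  proof -
    have "odd t \<and> 2 * 1 * t ^ 2 = m \<longleftrightarrow> t ^ 2 = 4 * int n + 1" for t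
    proof
      assume sq: "t ^ 2 = 4 * int n + 1"
      then have "odd (t ^ 2)" by simp
      then have "odd t" by simp
      with sq show "odd t \<and> 2 * 1 * t ^ 2 = m" by (simp add: m_def)
    qed (simp add: m_def)
    then show ?thesis by simp
  qed
  moreover have "(\<exists>t. odd t \<and> 2 * 5 * t ^ 2 = m) \<longleftrightarrow> (\<exists>t. 5 * t ^ 2 = 4 * int n + 1)"
  proof -
    have "odd t \<and> 2 * 5 * t ^ 2 = m \<longleftrightarrow> 5 * t ^ 2 = 4 * int n + 1" for t
    proof
      assume sq: "5 * t ^ 2 = 4 * int n + 1"
      then have "odd (5 * t ^ 2)" by simp
      then have "odd t" by simp
      with sq show "odd t \<and> 2 * 5 * t ^ 2 = m" by (simp add: m_def)
    qed (simp add: m_def)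
    then show ?thesis by simp
  qed
  ultimately show ?thesis by (simp only: parity_pos_odd_reps zero_less_one zero_less_numeral)
qed

lemma phi5_power_nth:
  "fps_nth (phi5 ^ k) n = (if 5 dvd n then fps_nth (phi ^ k) (n div 5) else 0)"
  by (simp add: phi5_conv_phi fps_compose_power fps_nth_compose_X_power)

text \<open>
  The square of \<open>phi\<^sup>3\<close> lives on even exponents only. Correspondingly \<open>4 n + 1\<close> can be a square only for
  even \<open>n\<close>, since odd squares are 1 modulo 8.
\<close>

lemma phi_power_6_nth: "fps_nth (phi ^ 6) n = of_bool (\<exists>t::int. t ^ 2 = 4 * int n + 1)"
proof -
  have "fps_nth (phi ^ 6) n = (if even n then fps_nth (phi ^ 3) (n div 2) else 0)"
    using bit_fps_square_nth[of "phi ^ 3" n] by (simp add: power_mult [symmetric])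
  also have "\<dots> = of_bool (\<exists>t::int. t ^ 2 = 4 * int n + 1)"
  proof (cases "even n")
    case True
    then show ?thesis by (auto simp: phi_cube_nth elim!: evenE)
  next
    case False
    have "t ^ 2 \<noteq> 4 * int n + 1" for t :: int
    proof
      assume t: "t ^ 2 = 4 * int n + 1"
      then have "odd (t ^ 2)" by simp
      then have "odd t" by simp
      then obtain j where "t ^ 2 = 8 * int j + 1" using odd_square_mod_8 by blast
      with t False show False by presburger
    qed
    with False show ?thesis by simp
  qed
  finally show ?thesis .
qed

lemma X_phi5_power_6_nth:
  "fps_nth (fps_X * phi5 ^ 6) n = of_bool (\<exists>t::int. 5 * t ^ 2 = 4 * int n + 1)"
proof -
  have "(\<exists>t::int. 5 * t ^ 2 = 4 * int n + 1)
      \<longleftrightarrow> n > 0 \<and> 5 dvd n - 1 \<and> (\<exists>t::int. t ^ 2 = 4 * int ((n - 1) div 5) + 1)"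
  proof (intro iffI; (elim exE conjE)?)
    fix t :: int assume t: "5 * t ^ 2 = 4 * int n + 1"
    have "5 dvd 4 * int n + 1" by (simp flip: t)
    then have "n mod 5 = 1" by presburger
    then have n: "n > 0" "5 dvd n - 1" by presburger+
    then have "int n = 5 * int ((n - 1) div 5) + 1" by auto
    with t have "t ^ 2 = 4 * int ((n - 1) div 5) + 1" by linarith
    with n show "n > 0 \<and> 5 dvd n - 1 \<and> (\<exists>t::int. t ^ 2 = 4 * int ((n - 1) div 5) + 1)"
      by blast
  next
    fix t :: int assume "n > 0" "5 dvd n - 1" "t ^ 2 = 4 * int ((n - 1) div 5) + 1"
    moreover from this have "int n = 5 * int ((n - 1) div 5) + 1" by auto
    ultimately show "\<exists>t::int. 5 * t ^ 2 = 4 * int n + 1" by (intro exI[of _ t]) linarith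
  qed
  then show ?thesis by (simp add: phi5_power_nth phi_power_6_nth)
qed

theorem phi_mult_phi5: "phi * phi5 = phi ^ 6 + fps_X * phi5 ^ 6"
  by (rule fps_ext) (simp add: phi_mult_phi5_nth phi_power_6_nth X_phi5_power_6_nth del: fps_X_mult_nth)

section \<open>The generating function modulo 2\<close>

definition fps_mod2 :: "int fps \<Rightarrow> bit fps" where
  "fps_mod2 f = Abs_fps (\<lambda>n. of_int (fps_nth f n))"

lemma fps_mod2_nth [simp]: "fps_nth (fps_mod2 f) n = of_int (fps_nth f n)"
  by (simp add: fps_mod2_def)

lemma fps_mod2_mult: "fps_mod2 (f * g) = fps_mod2 f * fps_mod2 g"
  by (rule fps_ext) (simp add: fps_mult_nth)

lemma fps_mod2_diff: "fps_mod2 (f - g) = fps_mod2 f - fps_mod2 g"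
  by (rule fps_ext) (simp only: fps_mod2_nth fps_sub_nth of_int_diff)

lemma fps_mod2_uminus: "fps_mod2 (- f) = fps_mod2 f"
  by (rule fps_ext) simp

lemma fps_mod2_1: "fps_mod2 1 = 1"
  by (rule fps_ext) simp

lemma fps_mod2_power: "fps_mod2 (f ^ n) = fps_mod2 f ^ n"
  by (induction n) (simp_all add: fps_mod2_1 fps_mod2_mult)

lemma fps_mod2_prod: "fps_mod2 (prod f A) = (\<Prod>x\<in>A. fps_mod2 (f x))"
  by (induction A rule: infinite_finite_induct) (simp_all add: fps_mod2_1 fps_mod2_mult)

lemma fps_mod2_X: "fps_mod2 fps_X = fps_X"
  by (rule fps_ext) (simp add: fps_X_def)

lemma fps_mod2_q_poch_inf:
  assumes "fps_nth a 0 = 0" "fps_nth q 0 = 0"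
  shows "fps_mod2 (q_poch_inf a q) = q_poch_inf (fps_mod2 a) (fps_mod2 q)"
proof (rule fps_ext)
  fix m
  have "fps_mod2 (q_poch a q n) = q_poch (fps_mod2 a) (fps_mod2 q) n" for n
    by (simp only: q_poch_def fps_mod2_prod fps_mod2_diff fps_mod2_1 fps_mod2_mult fps_mod2_power)
  moreover have "fps_nth (q_poch_inf a q) m = fps_nth (q_poch a q (Suc m)) m"
    using q_poch_inf_agree[OF assms, of m "Suc m"] by (simp add: fps_agree_def)
  moreover have "fps_nth (q_poch_inf (fps_mod2 a) (fps_mod2 q)) m
      = fps_nth (q_poch (fps_mod2 a) (fps_mod2 q) (Suc m)) m"
    using q_poch_inf_agree[of "fps_mod2 a" "fps_mod2 q" m "Suc m"] assms
    by (simp add: fps_agree_def)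
  ultimately show "fps_nth (fps_mod2 (q_poch_inf a q)) m
      = fps_nth (q_poch_inf (fps_mod2 a) (fps_mod2 q)) m"
    by (metis fps_mod2_nth)
qed

lemma phi_inverse: "phi * inverse phi = 1" and phi5_inverse: "phi5 * inverse phi5 = 1"
proof -
  have "fps_nth phi 0 = 1" "fps_nth phi5 0 = 1"
    by (simp_all add: phi_def phi5_def fps_nth_0_q_poch_inf)
  then show "phi * inverse phi = 1" "phi5 * inverse phi5 = 1"
    by (simp_all add: inverse_mult_eq_1')
qed

lemma bracelet_gf_mod2: "fps_mod2 (bracelet_gf 5) * (phi ^ 3 * phi5) = 1"
proof -
  have "fps_mod2 (bracelet_gf 5) * (phi ^ 4 * phi5) = phi"
    using arg_cong[OF bracelet_gf_mult_denom[of 5], of fps_mod2]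
    by (simp add: fps_mod2_mult fps_mod2_power fps_mod2_q_poch_inf fps_mod2_uminus fps_mod2_X
        phi_def phi5_def)
  then have "fps_mod2 (bracelet_gf 5) * (phi ^ 4 * phi5) * inverse phi = 1"
    by (simp add: phi_inverse)
  moreover have "g * (a ^ 4 * b) * i = g * (a ^ 3 * b) * (a * i)" for g a b i :: "bit fps"
    by (simp add: eval_nat_numeral algebra_simps)
  ultimately show ?thesis by (simp add: phi_inverse)
qed

text \<open>
  Squares are series in \<open>q\<^sup>2\<close>. Applied to \<open>phi_mult_phi5\<close> this performs each of the three dissections
  below.
\<close>

lemma even_odd_parts:
  fixes f u v :: "bit fps"
  assumes "f = u ^ 2 + fps_X * v ^ 2"
  shows "fps_nth f (2 * n) = fps_nth u n" "fps_nth f (2 * n + 1) = fps_nth v n"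
  unfolding assms by (cases "n = 0"; simp add: bit_fps_square_nth)+

text \<open>
  Writing \<open>1 / (a\<^sup>3 b) = a b / (a\<^sup>4 b\<^sup>2)\<close> with a square in the denominator gives \<open>(a / b)\<^sup>2 + q (b\<^sup>2 / a\<^sup>2)\<^sup>2\<close>.
  The next two dissections work in the same way.
\<close>

lemma bracelet_gf_even:
  "fps_nth (fps_mod2 (bracelet_gf 5)) (2 * n) = fps_nth (phi * inverse phi5) n"
proof (rule even_odd_parts(1))
  let ?i = "inverse phi" and ?j = "inverse phi5"
  have "fps_mod2 (bracelet_gf 5)
      = fps_mod2 (bracelet_gf 5) * (phi ^ 3 * phi5) * ((phi * phi5) * ?i ^ 4 * ?j ^ 2)"
  proof -
    have "(a ^ 3 * b) * ((a * b) * i ^ 4 * j ^ 2) = (a * i) ^ 4 * (b * j) ^ 2"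
      for a b i j :: "bit fps" by (simp add: eval_nat_numeral algebra_simps)
    then show ?thesis by (simp add: phi_inverse phi5_inverse mult.assoc)
  qed
  also have "\<dots> = (phi ^ 6 + fps_X * phi5 ^ 6) * ?i ^ 4 * ?j ^ 2"
    by (simp add: bracelet_gf_mod2 phi_mult_phi5)
  also have "\<dots> = (phi * ?j) ^ 2 * (phi * ?i) ^ 4
      + fps_X * (phi5 ^ 2 * ?i ^ 2) ^ 2 * (phi5 * ?j) ^ 2"
    by (simp add: eval_nat_numeral algebra_simps)
  also have "\<dots> = (phi * ?j) ^ 2 + fps_X * (phi5 ^ 2 * ?i ^ 2) ^ 2"
    by (simp add: phi_inverse phi5_inverse)
  finally show "fps_mod2 (bracelet_gf 5) = (phi * ?j) ^ 2 + fps_X * (phi5 ^ 2 * ?i ^ 2) ^ 2" .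
qed

text \<open>
  A factor that is a series in \<open>q\<^sup>d\<close> can be pulled out when the exponents in one class modulo \<open>d\<close>
  are extracted.
\<close>

lemma fps_compose_X_power_mult_section:
  fixes f g :: "'a::idom fps"
  assumes "r < d"
  shows "fps_nth (f * (g oo fps_X ^ d)) (d * n + r)
       = fps_nth (Abs_fps (\<lambda>m. fps_nth f (d * m + r)) * g) n"
proof -
  have "fps_nth (f * (g oo fps_X ^ d)) (d * n + r)
      = (\<Sum>i = 0..d * n + r. fps_nth (g oo fps_X ^ d) i * fps_nth f (d * n + r - i))"
    by (subst mult.commute) (simp add: fps_mult_nth)
  also have "\<dots> = (\<Sum>i \<in> (\<lambda>j. d * j) ` {0..n}. fps_nth (g oo fps_X ^ d) i * fps_nth f (d * n + r - i))"
  proof (rule sum.mono_neutral_right)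
    show "(\<lambda>j. d * j) ` {0..n} \<subseteq> {0..d * n + r}" by (auto intro!: trans_le_add1 mult_le_mono2)
    show "\<forall>i \<in> {0..d * n + r} - (\<lambda>j. d * j) ` {0..n}.
        fps_nth (g oo fps_X ^ d) i * fps_nth f (d * n + r - i) = 0"
    proof
      fix i assume i: "i \<in> {0..d * n + r} - (\<lambda>j. d * j) ` {0..n}"
      have "\<not> d dvd i"
      proof
        assume "d dvd i"
        then obtain j where j: "i = d * j" by (elim dvdE)
        with i have "d * j < d * Suc n" using assms by simp
        then have "j \<le> n" by (simp only: mult_less_cancel1 less_Suc_eq_le)
        with i j show False by auto
      qed
      then show "fps_nth (g oo fps_X ^ d) i * fps_nth f (d * n + r - i) = 0"
        by (simp add: fps_nth_compose_X_power)
    qed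
  qed simp
  also have "\<dots> = (\<Sum>j = 0..n. fps_nth g j * fps_nth f (d * (n - j) + r))"
    using assms
    by (subst sum.reindex)
       (auto simp: inj_on_def fps_nth_compose_X_power diff_mult_distrib2 intro!: sum.cong
         arg_cong[of _ _ "fps_nth f"])
  also have "\<dots> = fps_nth (g * Abs_fps (\<lambda>m. fps_nth f (d * m + r))) n"
    by (simp add: fps_mult_nth)
  finally show ?thesis by (simp only: mult.commute)
qed

text \<open>
  In the 5-dissection of \<open>phi\<close> the component with exponents 1 modulo 5 is \<open>q (q\<^bsup>25\<^esup>; q\<^bsup>25\<^esup>)\<^sub>\<infinity>\<close>: if
  \<open>n \<equiv> 1\<close> modulo 5, then \<open>24 n + 1\<close> is divisible by 5, and being a square also by 25.
\<close>

lemma phi_nth_5: "fps_nth phi (5 * k + 1) = fps_nth phi5 k"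
proof -
  have "(\<exists>x::int. x ^ 2 = 24 * int (5 * k + 1) + 1)
      \<longleftrightarrow> 5 dvd k \<and> (\<exists>x::int. x ^ 2 = 24 * int (k div 5) + 1)"
  proof (intro iffI; (elim exE conjE)?)
    fix x :: int assume "x ^ 2 = 24 * int (5 * k + 1) + 1"
    then have x: "x ^ 2 = 5 * (24 * int k + 5)" by simp
    then have "5 dvd x ^ 2" by simp
    then have "5 dvd x" by (rule prime_dvd_power_int[rotated]) simp
    then obtain y where y: "x = 5 * y" by (elim dvdE)
    have "5 * y ^ 2 = 24 * int k + 5" using x by (simp add: y power2_eq_square)
    moreover from this have "5 dvd 24 * int k + 5" by (metis dvd_triv_left)
    then have k: "5 dvd k" by presburger
    then have "int k = 5 * int (k div 5)" by auto
    ultimately have "y ^ 2 = 24 * int (k div 5) + 1" by linarith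
    with k show "5 dvd k \<and> (\<exists>x::int. x ^ 2 = 24 * int (k div 5) + 1)" by blast
  next
    fix y :: int assume "5 dvd k" "y ^ 2 = 24 * int (k div 5) + 1"
    moreover from this have "int k = 5 * int (k div 5)" by auto
    ultimately have "(5 * y) ^ 2 = 24 * int (5 * k + 1) + 1"
      by (simp add: power_mult_distrib)
    then show "\<exists>x::int. x ^ 2 = 24 * int (5 * k + 1) + 1" by blast
  qed
  then show ?thesis
    using phi5_power_nth[of 1 k] by (simp add: phi_nth)
qed

lemma phi_div_phi5_section:
  "fps_nth (phi * inverse phi5) (5 * k + 1) = fps_nth (phi5 * inverse phi) k"
proof -
  define h where "h = Abs_fps (\<lambda>m. fps_nth (phi * inverse phi5) (5 * m + 1))"
  have "h * phi = phi5"
  proof (rule fps_ext)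
    fix k
    have "fps_nth (h * phi) k = fps_nth ((phi * inverse phi5) * phi5) (5 * k + 1)"
      unfolding h_def phi5_conv_phi by (rule fps_compose_X_power_mult_section [symmetric]) simp
    also have "(phi * inverse phi5) * phi5 = phi"
      by (metis mult.assoc mult.commute mult_1_right phi5_inverse)
    finally show "fps_nth (h * phi) k = fps_nth phi5 k" by (simp only: phi_nth_5)
  qed
  then have "h = phi5 * inverse phi"
    by (metis mult.assoc mult_1_right phi_inverse)
  then show ?thesis
    by (metis h_def fps_nth_Abs_fps)
qed

lemma phi5_div_phi_odd:
  "fps_nth (phi5 * inverse phi) (2 * l + 1) = fps_nth (phi5 ^ 3 * inverse phi) l"
proof (rule even_odd_parts(2))
  let ?i = "inverse phi"
  have "phi5 * ?i = (phi * phi5) * ?i ^ 2"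
  proof -
    have "(a * b) * i ^ 2 = b * i * (a * i)" for a b i :: "bit fps"
      by (simp add: eval_nat_numeral algebra_simps)
    from this[of phi phi5 ?i] show ?thesis by (simp only: phi_inverse mult_1_right)
  qed
  also have "\<dots> = (phi ^ 6 + fps_X * phi5 ^ 6) * ?i ^ 2"
    by (simp add: phi_mult_phi5)
  also have "\<dots> = (phi ^ 2) ^ 2 * (phi * ?i) ^ 2 + fps_X * (phi5 ^ 3 * ?i) ^ 2"
    by (simp add: eval_nat_numeral algebra_simps)
  finally show "phi5 * ?i = (phi ^ 2) ^ 2 + fps_X * (phi5 ^ 3 * ?i) ^ 2"
    by (simp add: phi_inverse)
qed

lemma phi5_cube_div_phi_even:
  "fps_nth (phi5 ^ 3 * inverse phi) (2 * m) = fps_nth (phi ^ 2 * phi5) m"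
proof (rule even_odd_parts(1))
  let ?i = "inverse phi"
  have "phi5 ^ 3 * ?i = (phi * phi5) * (phi5 ^ 2 * ?i ^ 2)"
  proof -
    have "(a * b) * (b ^ 2 * i ^ 2) = b ^ 3 * i * (a * i)" for a b i :: "bit fps"
      by (simp add: eval_nat_numeral algebra_simps)
    from this[of phi phi5 ?i] show ?thesis by (simp only: phi_inverse mult_1_right)
  qed
  also have "\<dots> = (phi ^ 6 + fps_X * phi5 ^ 6) * (phi5 ^ 2 * ?i ^ 2)"
    by (simp add: phi_mult_phi5)
  also have "\<dots> = (phi ^ 2 * phi5) ^ 2 * (phi * ?i) ^ 2 + fps_X * (phi5 ^ 4 * ?i) ^ 2"
    by (simp add: eval_nat_numeral algebra_simps)
  finally show "phi5 ^ 3 * ?i = (phi ^ 2 * phi5) ^ 2 + fps_X * (phi5 ^ 4 * ?i) ^ 2"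
    by (simp add: phi_inverse)
qed

theorem bracelet_5_section:
  "(of_int (bracelet 5 (40 * m + 12)) :: bit) = fps_nth (phi ^ 2 * phi5) m"
proof -
  have "(of_int (bracelet 5 (40 * m + 12)) :: bit)
      = fps_nth (fps_mod2 (bracelet_gf 5)) (2 * (20 * m + 6))"
    by (simp add: bracelet_def)
  also have "\<dots> = fps_nth (phi * inverse phi5) (5 * (4 * m + 1) + 1)"
    unfolding bracelet_gf_even by (simp add: add.commute)
  also have "\<dots> = fps_nth (phi5 * inverse phi) (2 * (2 * m) + 1)"
    unfolding phi_div_phi5_section by simp
  also have "\<dots> = fps_nth (phi ^ 2 * phi5) m"
    unfolding phi5_div_phi_odd phi5_cube_div_phi_even ..
  finally show ?thesis .
qed

section \<open>Values of the form 2x^2 + 5y^2 and the congruence\<close>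

lemma phi_square_phi5_nth_nonzero:
  assumes "fps_nth (phi ^ 2 * phi5) m \<noteq> 0"
  shows "\<exists>x y :: int. 24 * int m + 7 = 2 * x ^ 2 + 5 * y ^ 2"
proof -
  from assms obtain i where i: "i \<le> m" "fps_nth (phi ^ 2) i * fps_nth phi5 (m - i) \<noteq> 0"
    unfolding fps_mult_nth by (metis (mono_tags, lifting) atLeastAtMost_iff sum.not_neutral_contains_not_neutral)
  from i(2) have 1: "even i" "fps_nth phi (i div 2) \<noteq> 0"
    by (auto simp: bit_fps_square_nth split: if_splits)
  from i(2) have 2: "5 dvd m - i" "fps_nth phi ((m - i) div 5) \<noteq> 0"
    using phi5_power_nth[of 1 "m - i"] by (auto split: if_splits)
  from 1(2) obtain x :: int where x: "x ^ 2 = 24 * int (i div 2) + 1"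
    by (auto simp: phi_nth split: if_splits)
  from 2(2) obtain y :: int where y: "y ^ 2 = 24 * int ((m - i) div 5) + 1"
    by (auto simp: phi_nth split: if_splits)
  have "int i = 2 * int (i div 2)" using 1(1) by auto
  moreover have "int m - int i = 5 * int ((m - i) div 5)"
    using 2(1) i(1) by (metis of_nat_diff of_nat_mult of_nat_numeral dvd_mult_div_cancel)
  moreover have "24 * k + 7 = 2 * (24 * u + 1) + 5 * (24 * v + 1)"
    if "l = 2 * u" "k - l = 5 * v" for k l u v :: int
    using that by simp
  ultimately have "24 * int m + 7 = 2 * x ^ 2 + 5 * y ^ 2"
    unfolding x y by blast
  then show ?thesis by blast
qed

text \<open>
  If \<open>y\<close> were invertible modulo \<open>p\<close>, then \<open>(2 x)\<^sup>2 \<equiv> -10 y\<^sup>2\<close> would make -10 a square.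
\<close>

lemma inert_prime_divides_both:
  fixes p x y :: int
  assumes "prime p" "odd p" "Legendre (-10) p = -1" "p dvd 2 * x ^ 2 + 5 * y ^ 2"
  shows "p dvd x" "p dvd y"
proof -
  have nores: "\<not> p dvd 10" "\<not> QuadRes p (-10)"
    using assms(3) by (auto simp: Legendre_def cong_0_iff split: if_splits)
  show y: "p dvd y"
  proof (rule ccontr)
    assume "\<not> p dvd y"
    then have "coprime y p"
      using assms(1) by (meson coprime_commute prime_imp_coprime)
    then obtain z where z: "[y * z = 1] (mod p)"
      using cong_solve_coprime_int by blast
    have "[(2 * x * z) ^ 2 = -10 * (y * z) ^ 2] (mod p)"
    proof -
      have "(2 * x * z) ^ 2 - (-10 * (y * z) ^ 2) = (2 * x ^ 2 + 5 * y ^ 2) * (2 * z ^ 2)"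
        by (simp add: power2_eq_square algebra_simps)
      then show ?thesis using assms(4) by (simp only: cong_iff_dvd_diff dvd_mult2)
    qed
    also have "[-10 * (y * z) ^ 2 = -10 * 1 ^ 2] (mod p)"
      using z by (intro cong_mult cong_pow) auto
    finally have "QuadRes p (-10)" by (auto simp: QuadRes_def)
    with nores show False by simp
  qed
  then have "p dvd 2 * x ^ 2"
    using assms(4) by (simp add: dvd_add_left_iff power2_eq_square)
  moreover have "\<not> p dvd 2"
    using assms(1,2) primes_dvd_imp_eq[of p 2] by auto
  ultimately have "p dvd x ^ 2"
    using assms(1) prime_dvd_mult_iff[of p 2 "x ^ 2"] by simp
  then show "p dvd x"
    using assms(1) prime_dvd_power by blast
qed

text \<open>
  Descent: \<open>p\<^sup>2\<close> divides the value, and the quotient is again a value of the form.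
\<close>

lemma inert_prime_even_valuation:
  fixes p x y :: int
  assumes "prime p" "odd p" "Legendre (-10) p = -1"
  shows "p ^ (2 * a + 1) dvd 2 * x ^ 2 + 5 * y ^ 2 \<Longrightarrow> p ^ (2 * a + 2) dvd 2 * x ^ 2 + 5 * y ^ 2"
proof (induction a arbitrary: x y)
  case 0
  then have "p dvd 2 * x ^ 2 + 5 * y ^ 2" by simp
  then have "p dvd x" "p dvd y" by (rule inert_prime_divides_both[OF assms])+
  then obtain u v where "x = p * u" "y = p * v" by (elim dvdE)
  then have "2 * x ^ 2 + 5 * y ^ 2 = p ^ 2 * (2 * u ^ 2 + 5 * v ^ 2)"
    by (simp only: power_mult_distrib) (simp only: algebra_simps)
  then have "p ^ 2 dvd 2 * x ^ 2 + 5 * y ^ 2" by simp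
  then show ?case by (simp only: mult_0_right add_0)
next
  case (Suc a)
  have "p dvd p ^ (2 * Suc a + 1)" by simp
  then have "p dvd 2 * x ^ 2 + 5 * y ^ 2" using Suc.prems by (rule dvd_trans)
  then have "p dvd x" "p dvd y" by (rule inert_prime_divides_both[OF assms])+
  then obtain u v where "x = p * u" "y = p * v" by (elim dvdE)
  then have uv: "2 * x ^ 2 + 5 * y ^ 2 = p ^ 2 * (2 * u ^ 2 + 5 * v ^ 2)"
    by (simp only: power_mult_distrib) (simp only: algebra_simps)
  have p: "p ^ 2 \<noteq> 0" using assms(1) by auto
  have e: "p ^ (2 * Suc a + 1) = p ^ 2 * p ^ (2 * a + 1)" "p ^ (2 * Suc a + 2) = p ^ 2 * p ^ (2 * a + 2)"
    by (simp_all flip: power_add)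
  from Suc.prems p have "p ^ (2 * a + 1) dvd 2 * u ^ 2 + 5 * v ^ 2"
    unfolding uv e by (simp only: dvd_mult_cancel_left simp_thms)
  from Suc.IH[OF this] show ?case
    unfolding uv e by (rule mult_dvd_mono[OF dvd_refl])
qed

theorem theorem2p5:
  fixes p \<alpha> n i :: nat
  assumes "prime p" and "p \<ge> 5" and "Legendre (-10) (int p) = -1"
    and "\<alpha> \<ge> 1" and "i \<in> {1..p - 1}"
  shows "[bracelet 5 (40 * p ^ (2 * \<alpha>) * n
            + (5 * (24 * i + 7 * p) * p ^ (2 * \<alpha> - 1) + 1) div 3) = 0] (mod 2)"
proof -
  define a where "a = \<alpha> - 1"
  have \<alpha>: "2 * \<alpha> = 2 * a + 2" "2 * \<alpha> - 1 = 2 * a + 1" using assms(4) by (simp_all add: a_def)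
  define N where "N = 40 * p ^ (2 * \<alpha>) * n + (5 * (24 * i + 7 * p) * p ^ (2 * \<alpha> - 1) + 1) div 3"
  have three: "3 dvd 5 * (24 * i + 7 * p) * p ^ (2 * \<alpha> - 1) + 1"
    using assms by (intro three_dvd_bracelet_index)
  have odd_p: "odd p" using assms(1,2) prime_odd_nat by simp
  \<comment> \<open>\<open>p\<close> is coprime to 24, so \<open>p\<^sup>2 \<equiv> 1\<close> modulo 24, and the \<open>m\<close> with
    \<open>24 m + 7 = p\<^bsup>2\<alpha>-1\<^esup> (24 (p n + i) + 7 p)\<close> is an integer.\<close>
  have p24: "p ^ (2 * \<alpha>) mod 24 = 1"
  proof -
    have "\<not> 3 dvd p" using assms(1,2) primes_dvd_imp_eq[of 3 p] by auto
    then have "p mod 3 = 1 \<or> p mod 3 = 2" by presburger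
    then have "(p mod 3) ^ 2 mod 3 = 1" by auto
    then have "p ^ 2 mod 3 = 1" by (simp add: power_mod)
    have "p mod 8 = 1 \<or> p mod 8 = 3 \<or> p mod 8 = 5 \<or> p mod 8 = 7"
      using odd_p by presburger
    then have "(p mod 8) ^ 2 mod 8 = 1" by auto
    then have "p ^ 2 mod 8 = 1" by (simp add: power_mod)
    have "coprime (3 :: nat) 8" by (rule prime_imp_coprime) simp_all
    with \<open>p ^ 2 mod 3 = 1\<close> \<open>p ^ 2 mod 8 = 1\<close> have "p ^ 2 mod 24 = 1"
      using coprime_cong_mult_nat[of "p ^ 2" 1 3 8] by (simp add: cong_def)
    then show ?thesis using power_mod[of "p ^ 2" 24 \<alpha>] by (simp add: power_mult)
  qed
  define m where "m = p ^ (2 * \<alpha>) * n + i * p ^ (2 * \<alpha> - 1) + 7 * (p ^ (2 * \<alpha>) div 24)"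
  have pp: "p ^ (2 * \<alpha>) = p * p ^ (2 * \<alpha> - 1)" unfolding \<alpha> by simp
  have p24': "p ^ (2 * \<alpha>) = 24 * (p ^ (2 * \<alpha>) div 24) + 1"
    using p24 by (metis mult_div_mod_eq)
  have m: "24 * m + 7 = p ^ (2 * \<alpha> - 1) * (24 * (p * n + i) + 7 * p)"
  proof -
    have "24 * m + 7 = 24 * p ^ (2 * \<alpha>) * n + 24 * i * p ^ (2 * \<alpha> - 1) + 7 * p ^ (2 * \<alpha>)"
      using p24' by (simp add: m_def)
    then show ?thesis unfolding pp by (simp add: algebra_simps)
  qed
  have N: "N = 40 * m + 12"
  proof -
    have "3 * N = 120 * p ^ (2 * \<alpha>) * n + (5 * (24 * i + 7 * p) * p ^ (2 * \<alpha> - 1) + 1)"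
      using three by (simp add: N_def)
    also have "\<dots> = 5 * (24 * m + 7) + 1"
      unfolding m pp by (simp add: algebra_simps)
    finally show ?thesis by simp
  qed
  have "fps_nth (phi ^ 2 * phi5) m = 0"
  proof (rule ccontr)
    assume "fps_nth (phi ^ 2 * phi5) m \<noteq> 0"
    then obtain x y :: int where xy: "24 * int m + 7 = 2 * x ^ 2 + 5 * y ^ 2"
      using phi_square_phi5_nth_nonzero by blast
    have im: "24 * int m + 7 = int p ^ (2 * a + 1) * int (24 * (p * n + i) + 7 * p)"
      using arg_cong[OF m, of int] unfolding \<alpha> by simp
    have "int p ^ (2 * a + 1) dvd 2 * x ^ 2 + 5 * y ^ 2"
      unfolding xy [symmetric] im by simp
    then have "int p ^ (2 * a + 2) dvd 2 * x ^ 2 + 5 * y ^ 2"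
      using assms(1,3) odd_p by (intro inert_prime_even_valuation) auto
    then have "int p ^ (2 * a + 1) * int p dvd int p ^ (2 * a + 1) * int (24 * (p * n + i) + 7 * p)"
      unfolding xy [symmetric] im by (simp add: mult_ac)
    then have "int p dvd int (24 * (p * n + i) + 7 * p)"
      using assms(2) by (subst (asm) dvd_mult_cancel_left) auto
    then have "p dvd 24 * i + p * (24 * n + 7)"
      by (simp only: of_nat_dvd_iff) (simp add: algebra_simps)
    then have "p dvd 24 * i" by (simp add: dvd_add_left_iff)
    moreover have "\<not> p dvd 24"
    proof
      assume "p dvd 24"
      then have "p dvd 2 ^ 3 * 3" by simp
      then have "p dvd 2 \<or> p dvd 3"
        using assms(1) prime_dvd_mult_iff[of p "2 ^ 3" 3] prime_dvd_power[of p 2 3] by blast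
      then show False using assms(2) by (auto dest: dvd_imp_le)
    qed
    ultimately have "p dvd i" using assms(1) prime_dvd_mult_iff by blast
    with assms(5) show False by (auto dest: dvd_imp_le)
  qed
  then have "(of_int (bracelet 5 N) :: bit) = 0"
    unfolding N bracelet_5_section .
  moreover have "(of_int k :: bit) = 1" if "odd k" for k :: int
    using that by (elim oddE) simp
  ultimately have "even (bracelet 5 N)"
    by (metis zero_neq_one)
  then show ?thesis
    by (simp add: N_def cong_0_iff)
qed

end
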